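(* Let $0<n<\omega$. The following statements are equivalent for all cardinals $\kappa$: (i) $\kappa$ is $n$-huge. (ii) For all sufficiently large cardinals $\theta$, there is a small embedding $j:M\longrightarrow \mathrm{H}(\theta)$ for $\kappa$ such that $j^i(\mathrm{crit}(j))\in M$ for all $i\leq n$ and $$\{A\in\mathcal{P}(\mathcal{P}(j^n(\mathrm{crit}(j))))^M\mid j[j^n(\mathrm{crit}(j))]\in j(A)\}\ \in\ M.$$
   Context: $\mathrm{H}(\theta)$ is the set of all sets whose transitive closure has cardinality less than $\theta$. An elementary embedding $j:M\to N$ between transitive classes is non-trivial if there is an ordinal $\alpha\in M$ with $j(\alpha)>\alpha$; then $\mathrm{crit}(j)$ denotes the least such ordinal. Given cardinals $\kappa<\theta$, a non-trivial elementary embedding $j:M\to \mathrm{H}(\theta)$ is a small embedding for $\kappa$ if $M\in \mathrm{H}(\theta)$ is transitive and $j(\mathrm{crit}(j))=\kappa$. "For all sufficiently large cardinals $\theta$" means: there is an ordinal $\alpha\geq\kappa$ such that the statement holds for all cardinals $\theta>\alpha$. $j^i$ denotes the $i$-fold iterate of $j$ (with $j^0$ the identity), and $j[x]=\{j(y)\mid y\in x\}$. For $0<n<\omega$, an uncountable cardinal $\kappa$ is $n$-huge if there is a sequence $\kappa=\lambda_0<\lambda_1<\ldots<\lambda_n$ of cardinals and a $\kappa$-complete normal ultrafilter $U$ on $\mathcal{P}(\lambda_n)$ with $\{a\in\mathcal{P}(\lambda_n)\mid \mathrm{otp}(a\cap\lambda_{i+1})=\lambda_i\}\in U$ for all $i<n$.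 *)

theory Defs
  imports "HOL-Library.Equipollence" "HOL-Library.FuncSet" "HOL-Library.Countable_Set"
begin

text \<open>
  The universe of sets is a type \<open>'v\<close> whose elements are the sets, \<open>elts x\<close> being the
  collection of the members of \<open>x\<close>. Proper classes are HOL sets of type \<open>'v set\<close>, class
  functions are HOL functions \<open>'v \<Rightarrow> 'v\<close>, and separation and replacement range over all of them.
  The axiom of choice needs no separate clause: it follows from Hilbert choice together
  with replacement.
\<close>

class zfc =
  fixes elts :: "'a \<Rightarrow> 'a set"
  assumes extensionality: "elts x = elts y \<Longrightarrow> x = y"
    and foundation: "wf {(x, y). x \<in> elts y}"
    and pairing: "\<exists>z. elts z = {x, y}"
    and union: "\<exists>z. elts z = (\<Union>y\<in>elts x. elts y)"
    and powerset: "\<exists>z. elts z = {y. elts y \<subseteq> elts x}"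
    and infinity: "\<exists>w. (\<exists>e\<in>elts w. elts e = {}) \<and>
                       (\<forall>x\<in>elts w. \<exists>y\<in>elts w. elts y = insert x (elts x))"
    and separation: "\<exists>z. elts z = {y \<in> elts x. P y}"
    and replacement: "\<exists>z. elts z = f ` elts x"

text \<open>The set with a given extension; only meaningful for extensions that are not proper classes.\<close>

definition vset :: "'v::zfc set \<Rightarrow> 'v" where
  "vset A = (THE x. elts x = A)"

lemma elts_vset: "elts z = A \<Longrightarrow> elts (vset A) = A"
  unfolding vset_def by (rule theI2[where a = z]) (auto intro: extensionality)

lemma elts_vset_subset: "A \<subseteq> elts x \<Longrightarrow> elts (vset A) = A"
proof -
  assume "A \<subseteq> elts x"
  then have "A = {y \<in> elts x. y \<in> A}" by auto
  moreover obtain z where "elts z = {y \<in> elts x. y \<in> A}"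
    using separation[of x "\<lambda>y. y \<in> A"] by blast
  ultimately show ?thesis using elts_vset[of z A] by simp
qed

lemma elts_vset_image:
  fixes f :: "'v::zfc \<Rightarrow> 'v"
  shows "elts (vset (f ` elts x)) = f ` elts x"
  using replacement[of f x] elts_vset by blast

definition vpow :: "'v::zfc \<Rightarrow> 'v" where
  "vpow x = vset {y. elts y \<subseteq> elts x}"

lemma elts_vpow: "elts (vpow x) = {y. elts y \<subseteq> elts x}"
  unfolding vpow_def using powerset[of x] elts_vset by blast

text \<open>The power set as computed in a transitive set \<open>M\<close>.\<close>

definition vpow_in :: "'v::zfc \<Rightarrow> 'v \<Rightarrow> 'v" where
  "vpow_in M x = vset {y \<in> elts M. elts y \<subseteq> elts x}"

lemma elts_vpow_in: "elts (vpow_in M x) = {y \<in> elts M. elts y \<subseteq> elts x}"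
  unfolding vpow_in_def by (rule elts_vset_subset[of _ M]) auto

definition transitive_set :: "'v::zfc \<Rightarrow> bool" where
  "transitive_set x \<longleftrightarrow> (\<forall>y\<in>elts x. elts y \<subseteq> elts x)"

definition ordinal :: "'v::zfc \<Rightarrow> bool" where
  "ordinal x \<longleftrightarrow> transitive_set x \<and> (\<forall>y\<in>elts x. transitive_set y)"

text \<open>Cardinals are initial ordinals. By replacement, maps between (the extensions of) two sets
  in HOL correspond to sets of pairs, so the library's comparison of sizes is the internal one.\<close>

definition cardinal :: "'v::zfc \<Rightarrow> bool" where
  "cardinal k \<longleftrightarrow> ordinal k \<and> (\<forall>a\<in>elts k. elts a \<prec> elts k)"

definition trans_closure :: "'v::zfc \<Rightarrow> 'v set" where
  "trans_closure x = {y. (y, x) \<in> {(a, b). a \<in> elts b}\<^sup>+}"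

definition H :: "'v::zfc \<Rightarrow> 'v set" where
  "H \<theta> = {x. trans_closure x \<prec> elts \<theta>}"

definition otp :: "'v::zfc set \<Rightarrow> 'v" where
  "otp X = (THE a. ordinal a \<and>
     (\<exists>f. bij_betw f (elts a) X \<and>
          (\<forall>x\<in>elts a. \<forall>y\<in>elts a. x \<in> elts y \<longleftrightarrow> f x \<in> elts (f y))))"

text \<open>First-order formulas in the language of set theory, with variables indexed by \<open>nat\<close>,
  and their satisfaction in \<open>(M, \<in>)\<close> under an assignment \<open>e\<close>.\<close>

datatype formula =
    FMem nat nat
  | FEq nat nat
  | FNot formula
  | FAnd formula formula
  | FAll nat formula

primrec sat :: "'v::zfc set \<Rightarrow> (nat \<Rightarrow> 'v) \<Rightarrow> formula \<Rightarrow> bool" where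
  "sat M e (FMem i k) \<longleftrightarrow> e i \<in> elts (e k)"
| "sat M e (FEq i k) \<longleftrightarrow> e i = e k"
| "sat M e (FNot \<phi>) \<longleftrightarrow> \<not> sat M e \<phi>"
| "sat M e (FAnd \<phi> \<psi>) \<longleftrightarrow> sat M e \<phi> \<and> sat M e \<psi>"
| "sat M e (FAll i \<phi>) \<longleftrightarrow> (\<forall>x\<in>M. sat M (e(i := x)) \<phi>)"

text \<open>An embedding is represented by a total function of which only the values on \<open>M\<close> matter.\<close>

definition elementary_embedding :: "'v::zfc set \<Rightarrow> 'v set \<Rightarrow> ('v \<Rightarrow> 'v) \<Rightarrow> bool" where
  "elementary_embedding M N j \<longleftrightarrow> j \<in> M \<rightarrow> N \<and>
     (\<forall>\<phi> e. range e \<subseteq> M \<longrightarrow> (sat M e \<phi> \<longleftrightarrow> sat N (j \<circ> e) \<phi>))"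

definition moved_ordinals :: "'v::zfc set \<Rightarrow> ('v \<Rightarrow> 'v) \<Rightarrow> 'v set" where
  "moved_ordinals M j = {a \<in> M. ordinal a \<and> a \<in> elts (j a)}"

definition nontrivial :: "'v::zfc set \<Rightarrow> ('v \<Rightarrow> 'v) \<Rightarrow> bool" where
  "nontrivial M j \<longleftrightarrow> moved_ordinals M j \<noteq> {}"

definition crit :: "'v::zfc set \<Rightarrow> ('v \<Rightarrow> 'v) \<Rightarrow> 'v" where
  "crit M j = (THE a. a \<in> moved_ordinals M j \<and> (\<forall>b\<in>moved_ordinals M j. elts a \<subseteq> elts b))"

definition small_embedding :: "'v::zfc \<Rightarrow> 'v \<Rightarrow> 'v \<Rightarrow> ('v \<Rightarrow> 'v) \<Rightarrow> bool" where
  "small_embedding \<kappa> \<theta> M j \<longleftrightarrow>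
     cardinal \<kappa> \<and> cardinal \<theta> \<and> \<kappa> \<in> elts \<theta> \<and>
     M \<in> H \<theta> \<and> transitive_set M \<and>
     elementary_embedding (elts M) (H \<theta>) j \<and> nontrivial (elts M) j \<and>
     j (crit (elts M) j) = \<kappa>"

definition for_all_sufficiently_large_cardinals :: "'v::zfc \<Rightarrow> ('v \<Rightarrow> bool) \<Rightarrow> bool" where
  "for_all_sufficiently_large_cardinals \<kappa> P \<longleftrightarrow>
     (\<exists>\<alpha>. ordinal \<alpha> \<and> elts \<kappa> \<subseteq> elts \<alpha> \<and> (\<forall>\<theta>. cardinal \<theta> \<and> \<alpha> \<in> elts \<theta> \<longrightarrow> P \<theta>))"

definition ultrafilter_on :: "'a set \<Rightarrow> 'a set set \<Rightarrow> bool" where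
  "ultrafilter_on S U \<longleftrightarrow>
     U \<subseteq> Pow S \<and> S \<in> U \<and> {} \<notin> U \<and>
     (\<forall>X\<in>U. \<forall>Y. X \<subseteq> Y \<and> Y \<subseteq> S \<longrightarrow> Y \<in> U) \<and>
     (\<forall>X\<in>U. \<forall>Y\<in>U. X \<inter> Y \<in> U) \<and>
     (\<forall>X. X \<subseteq> S \<longrightarrow> X \<in> U \<or> S - X \<in> U)"

definition kappa_complete :: "'v::zfc \<Rightarrow> 'a set set \<Rightarrow> bool" where
  "kappa_complete \<kappa> U \<longleftrightarrow> (\<forall>F. F \<subseteq> U \<and> F \<noteq> {} \<and> F \<prec> elts \<kappa> \<longrightarrow> \<Inter>F \<in> U)"

text \<open>Normality of an ultrafilter on \<open>\<P>(\<lambda>)\<close>: as usual, a normal ultrafilter is by definition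
  fine (first conjunct). Without fineness, principal ultrafilters would qualify.\<close>

definition normal_on_vpow :: "'v::zfc \<Rightarrow> 'v set set \<Rightarrow> bool" where
  "normal_on_vpow l U \<longleftrightarrow>
     (\<forall>\<alpha>\<in>elts l. {a \<in> elts (vpow l). \<alpha> \<in> elts a} \<in> U) \<and>
     (\<forall>f \<in> elts (vpow l) \<rightarrow> elts l.
        {a \<in> elts (vpow l). f a \<in> elts a} \<in> U \<longrightarrow>
        (\<exists>\<alpha>\<in>elts l. {a \<in> elts (vpow l). f a = \<alpha>} \<in> U))"

text \<open>Only \<open>\<Lambda> 0, \<dots>, \<Lambda> n\<close> matter. The ultrafilter is given by the extensions of
  its members, which are subsets of a set.\<close>

definition n_huge :: "nat \<Rightarrow> 'v::zfc \<Rightarrow> bool" where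
  "n_huge n \<kappa> \<longleftrightarrow>
     cardinal \<kappa> \<and> uncountable (elts \<kappa>) \<and>
     (\<exists>\<Lambda> :: nat \<Rightarrow> 'v.
        \<Lambda> 0 = \<kappa> \<and> (\<forall>i\<le>n. cardinal (\<Lambda> i)) \<and> (\<forall>i<n. \<Lambda> i \<in> elts (\<Lambda> (Suc i))) \<and>
        (\<exists>U. ultrafilter_on (elts (vpow (\<Lambda> n))) U \<and> kappa_complete \<kappa> U \<and> normal_on_vpow (\<Lambda> n) U \<and>
             (\<forall>i<n. {a \<in> elts (vpow (\<Lambda> n)). otp (elts a \<inter> elts (\<Lambda> (Suc i))) = \<Lambda> i} \<in> U)))"

end

theory Submission
  imports Defs "HOL-Library.Countable"
begin

text \<open>
  Suppose \<open>U\<close> witnesses that \<open>\<kappa>\<close> is \<open>n\<close>-huge, with cardinals \<open>\<kappa> = \<Lambda> 0 < \<dots> < \<Lambda> n\<close>. The usual argument applies the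
  ultrapower embedding \<open>i\<close> to a small elementary submodel of \<open>H \<theta>\<close> and pulls the resulting small embedding
  back by elementarity of \<open>i\<close>. Here the ultrapower is unfolded: what it says about its seed \<open>i[\<Lambda> n]\<close> is a
  statement about \<open>U\<close>-almost all \<open>a \<subseteq> \<Lambda> n\<close>. So for each \<open>a\<close> let \<open>X\<close> be the Skolem hull in \<open>H \<theta>\<close> of \<open>a\<close>
  together with the parameters \<open>\<Lambda> i\<close> and \<open>U\<close>. Normality says that \<open>U\<close> is closed under diagonal intersections;
  iterating these over the finitely many generators of a Skolem term, and over the countably many terms,
  almost every \<open>a\<close> has \<open>X \<inter> \<Lambda> n = a\<close>, and it decides \<open>U\<close> on \<open>X\<close>: a set \<open>B \<in> X\<close> of subsets of \<open>\<Lambda> n\<close> is in \<open>U\<close>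
  iff \<open>a \<in> B\<close> (\<open>ae_skterm\<close>, \<open>ae_good\<close>). For such an \<open>a\<close> the inverse of the transitive collapse of \<open>X\<close> is the
  desired embedding, and the measure that is required to belong to \<open>M\<close> is the collapse of \<open>U\<close> (\<open>exists_small_embedding\<close>).

  Conversely, one embedding \<open>j\<close> of \<open>M\<close> into \<open>H \<theta>\<close> with \<open>\<theta>\<close> a strong limit is enough. Let \<open>l\<close> be the \<open>n\<close>-th
  iterated image of the critical point, \<open>s = j[l]\<close>, and let \<open>W \<in> M\<close> be the set of all \<open>A\<close> with \<open>s \<in> j A\<close>. Membership in \<open>W\<close> is truth
  at the seed \<open>s\<close>, and therefore \<open>M\<close> believes that \<open>W\<close> is a normal ultrafilter as required for hugeness of the
  critical point; the order types are right because \<open>s \<inter> j \<gamma> = j[\<gamma>]\<close> has order type \<open>\<gamma>\<close> for \<open>\<gamma> \<le> l\<close>. By elementarity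
  \<open>H \<theta>\<close> believes the same of \<open>j W\<close> and \<open>\<kappa>\<close>. This belief is correct because \<open>H \<theta>\<close> is closed under power sets
  (\<open>U_ultrafilter\<close>, \<open>U_normal\<close>, \<open>U_complete\<close>, \<open>V_otp\<close>).
\<close>

section \<open>Sets, ordinals and cardinals\<close>

lemma mem_induct: "(\<And>x. (\<And>y. y \<in> elts x \<Longrightarrow> P y) \<Longrightarrow> P x) \<Longrightarrow> P (x::'v::zfc)"
  using wf_induct_rule[OF foundation, of P x] by auto

lemma mem_minimal:
  fixes S :: "'v::zfc set"
  assumes "S \<noteq> {}"
  obtains m where "m \<in> S" and "\<And>y. y \<in> elts m \<Longrightarrow> y \<notin> S"
  using wfE_min'[OF foundation assms] by (metis case_prodI mem_Collect_eq)

lemma mem_irrefl: "(x::'v::zfc) \<notin> elts x"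
  using wf_not_refl[OF foundation] by auto

lemma mem_asym: "(x::'v::zfc) \<in> elts y \<Longrightarrow> y \<notin> elts x"
  using wf_asym[OF foundation] by auto

text \<open>Smallness separates sets from proper classes. By replacement, a collection that injects into a set
  is small.\<close>

definition small :: "'v::zfc set \<Rightarrow> bool" where
  "small A \<longleftrightarrow> (\<exists>z. elts z = A)"

lemma small_elts [simp]: "small (elts z)"
  unfolding small_def by blast

lemma elts_vset_small: "small A \<Longrightarrow> elts (vset A) = A"
  unfolding small_def using elts_vset by blast

lemma small_subset: "small B \<Longrightarrow> A \<subseteq> B \<Longrightarrow> small A"
  unfolding small_def using elts_vset_subset[of A] by blast

lemma small_image: "small A \<Longrightarrow> small ((f :: 'v::zfc \<Rightarrow> 'v) ` A)"
  unfolding small_def using replacement[of f] by blast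

lemma small_lepoll:
  fixes A :: "'v::zfc set"
  assumes "A \<lesssim> elts (z::'v)" shows "small A"
proof -
  obtain g where "A \<subseteq> g ` elts z" using assms unfolding lepoll_iff by auto
  then show ?thesis using small_subset[OF small_image[OF small_elts]] by blast
qed

lemma small_Union: "small A \<Longrightarrow> small (\<Union>y\<in>A. elts y)"
  unfolding small_def using union by blast

lemma small_UN:
  fixes f :: "'v::zfc \<Rightarrow> 'v set"
  assumes "small A" and "\<And>x. x \<in> A \<Longrightarrow> small (f x)"
  shows "small (\<Union>x\<in>A. f x)"
proof -
  have "small (\<Union>y\<in>(vset \<circ> f) ` A. elts y)"
    using small_Union[OF small_image[OF assms(1), of "vset \<circ> f"]] .
  also have "(\<Union>y\<in>(vset \<circ> f) ` A. elts y) = (\<Union>x\<in>A. f x)"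
    using assms(2) by (auto simp: elts_vset_small)
  finally show ?thesis .
qed

lemma small_pair: "small {x, y}"
  unfolding small_def using pairing .

lemma vset_elts [simp]: "vset (elts x) = x"
  by (rule extensionality) (simp add: elts_vset_small)

lemma small_insert: "small A \<Longrightarrow> small (insert x A)"
proof -
  assume "small A"
  then have "small (\<Union>y\<in>{vset {x, x}, vset A}. elts y)" by (intro small_Union small_pair)
  then show ?thesis using \<open>small A\<close> by (simp add: elts_vset_small small_pair[of x x, simplified])
qed

text \<open>The finite von Neumann ordinals, which embed the natural numbers of HOL into the universe: this
  makes countable sequences sets and shows that nonzero limit ordinals are infinite.\<close>

primrec vnat :: "nat \<Rightarrow> 'v::zfc" where
  "vnat 0 = vset {}"
| "vnat (Suc k) = vset (insert (vnat k) (elts (vnat k)))"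

lemma elts_empty [simp]: "elts (vset {}) = {}"
  using elts_vset_small[OF small_subset[OF small_elts]] by blast

lemma elts_vnat: "elts (vnat k :: 'v::zfc) = vnat ` {..<k}"
proof (induction k)
  case (Suc k)
  have "elts (vnat (Suc k) :: 'v) = insert (vnat k) (elts (vnat k))"
    by (simp add: elts_vset_small small_insert)
  also have "\<dots> = vnat ` {..<Suc k}" by (simp only: Suc lessThan_Suc image_insert)
  finally show ?case .
qed simp

lemma inj_vnat: "inj (vnat :: nat \<Rightarrow> 'v::zfc)"
proof (rule linorder_injI)
  fix k m :: nat assume "k < m"
  then have "(vnat k :: 'v) \<in> elts (vnat m)" by (auto simp: elts_vnat)
  then show "vnat k \<noteq> (vnat m :: 'v)" using mem_irrefl by metis
qed

lemma small_range_vnat: "small (range (vnat :: nat \<Rightarrow> 'v::zfc))"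
proof -
  obtain w e :: 'v where e: "e \<in> elts w" "elts e = {}"
    and w: "\<forall>x\<in>elts w. \<exists>y\<in>elts w. elts y = insert x (elts x)"
    using infinity by blast
  have "vnat k \<in> elts w" for k
  proof (induction k)
    case 0 then show ?case using e by (metis vnat.simps(1) vset_elts)
  next
    case (Suc k) then show ?case using w by (metis vnat.simps(2) vset_elts)
  qed
  then show ?thesis using small_subset[OF small_elts[of w]] by blast
qed

lemma small_range_nat: "small (range (f :: nat \<Rightarrow> 'v::zfc))"
proof -
  have "range f = (f \<circ> inv vnat) ` range (vnat :: nat \<Rightarrow> 'v)"
    by (simp add: image_comp [symmetric] image_image inj_vnat)
  then show ?thesis using small_image[OF small_range_vnat] by metis
qed

subsection \<open>Ordinals\<close>

lemma transitiveD: "transitive_set x \<Longrightarrow> y \<in> elts x \<Longrightarrow> z \<in> elts y \<Longrightarrow> z \<in> elts x"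
  unfolding transitive_set_def by blast

lemma ordinal_transitive: "ordinal x \<Longrightarrow> transitive_set x"
  unfolding ordinal_def by blast

lemmas ordinal_transD = transitiveD[OF ordinal_transitive]

lemma ordinal_subset: "ordinal x \<Longrightarrow> y \<in> elts x \<Longrightarrow> elts y \<subseteq> elts x"
  using ordinal_transD by blast

lemma ordinal_elt: "ordinal x \<Longrightarrow> y \<in> elts x \<Longrightarrow> ordinal y"
  unfolding ordinal_def transitive_set_def by blast

text \<open>By induction on \<open>a\<close> and then on \<open>b\<close>: if neither ordinal has an element equal to or beyond the
  other one, each element of either belongs to the other, so they are equal.\<close>

lemma ordinal_linear:
  assumes "ordinal a" "ordinal b"
  shows "a \<in> elts b \<or> a = b \<or> b \<in> elts a"
  using assms
proof (induction a arbitrary: b rule: mem_induct)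
  case (1 a)
  note IHa = 1(1) and a = \<open>ordinal a\<close>
  show ?case using \<open>ordinal b\<close>
  proof (induction b rule: mem_induct)
    case (1 b)
    note b = \<open>ordinal b\<close>
    show ?case
    proof (rule ccontr)
      assume neg: "\<not> ?case"
      have "x \<in> elts b" if "x \<in> elts a" for x
        using IHa[OF that ordinal_elt[OF a that] b] neg that ordinal_transD[OF a that] by blast
      moreover have "x \<in> elts a" if "x \<in> elts b" for x
        using 1(1)[OF that ordinal_elt[OF b that]] neg that ordinal_transD[OF b that] by blast
      ultimately show False using neg extensionality[of a b] by blast
    qed
  qed
qed

lemma ordinal_subset_iff: "ordinal a \<Longrightarrow> ordinal b \<Longrightarrow> elts a \<subseteq> elts b \<longleftrightarrow> a \<in> elts b \<or> a = b"
  using ordinal_linear ordinal_subset mem_irrefl by blast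

lemma ordinal_least:
  assumes "S \<noteq> {}" "\<And>x. x \<in> S \<Longrightarrow> ordinal x"
  obtains m where "m \<in> S" "\<And>x. x \<in> S \<Longrightarrow> elts m \<subseteq> elts x"
proof -
  obtain m where m: "m \<in> S" "\<And>y. y \<in> elts m \<Longrightarrow> y \<notin> S" using mem_minimal[OF assms(1)] by blast
  moreover have "elts m \<subseteq> elts x" if "x \<in> S" for x
    using m that assms(2) ordinal_linear[of m x] ordinal_subset_iff by blast
  ultimately show thesis using that by blast
qed

lemma ordinal_vset:
  assumes "small A" "\<And>x. x \<in> A \<Longrightarrow> ordinal x" "\<And>x. x \<in> A \<Longrightarrow> elts x \<subseteq> A"
  shows "ordinal (vset A)"
  using assms unfolding ordinal_def transitive_set_def by (simp add: elts_vset_small)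

lemma ordinal_vnat: "ordinal (vnat k :: 'v::zfc)"
proof (induction k rule: less_induct)
  case (less k)
  have "ordinal (vset (elts (vnat k :: 'v)))"
    by (rule ordinal_vset, simp) (use less in \<open>auto simp: elts_vnat\<close>)
  then show ?case by simp
qed

text \<open>An isomorphism between ordinals fixes every element, by induction, so it is the identity.\<close>

lemma ordinal_iso_unique:
  assumes a: "ordinal a" and b: "ordinal b" and h: "bij_betw h (elts a) (elts b)"
    and iso: "\<And>x y. x \<in> elts a \<Longrightarrow> y \<in> elts a \<Longrightarrow> x \<in> elts y \<longleftrightarrow> h x \<in> elts (h y)"
  shows "a = b"
proof -
  have "x \<in> elts a \<longrightarrow> h x = x" for x
  proof (induction x rule: mem_induct)
    case (1 x)
    show ?case
    proof
      assume x: "x \<in> elts a"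
      have IH: "h y = y" if "y \<in> elts x" for y using 1 that ordinal_transD[OF a x] by blast
      have hx: "h x \<in> elts b" using h x by (auto simp: bij_betw_def)
      show "h x = x"
      proof (rule extensionality, rule equalityI)
        show "elts (h x) \<subseteq> elts x"
        proof
          fix z assume z: "z \<in> elts (h x)"
          then have "z \<in> elts b" using ordinal_transD[OF b hx] by blast
          then obtain y where y: "y \<in> elts a" "z = h y" using h by (auto simp: bij_betw_def)
          then have "y \<in> elts x" using iso[OF y(1) x] z by blast
          then show "z \<in> elts x" using IH y by simp
        qed
        show "elts x \<subseteq> elts (h x)"
        proof
          fix y assume y: "y \<in> elts x"
          then have "h y \<in> elts (h x)" using iso[OF _ x] ordinal_transD[OF a x] by blast
          then show "y \<in> elts (h x)" using IH[OF y] by simp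
        qed
      qed
    qed
  qed
  then have "h ` elts a = elts a" by force
  then show ?thesis using h by (simp add: bij_betw_def extensionality)
qed

text \<open>Two ordinals isomorphic to the same set are isomorphic to each other and hence equal, so the
  definite description in the order type is determined by any one isomorphism.\<close>

lemma otp_eq:
  fixes f :: "'v::zfc \<Rightarrow> 'v"
  assumes a: "ordinal a" and f: "bij_betw f (elts a) X"
    and iso: "\<And>x y. x \<in> elts a \<Longrightarrow> y \<in> elts a \<Longrightarrow> x \<in> elts y \<longleftrightarrow> f x \<in> elts (f y)"
  shows "otp X = a"
  unfolding otp_def
proof (rule the_equality)
  show "ordinal a \<and> (\<exists>f. bij_betw f (elts a) X \<and>
          (\<forall>x\<in>elts a. \<forall>y\<in>elts a. x \<in> elts y \<longleftrightarrow> f x \<in> elts (f y)))"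
    using assms by blast
next
  fix b :: 'v
  assume "ordinal b \<and> (\<exists>f. bij_betw f (elts b) X \<and>
          (\<forall>x\<in>elts b. \<forall>y\<in>elts b. x \<in> elts y \<longleftrightarrow> f x \<in> elts (f y)))"
  then obtain g where b: "ordinal b" and g: "bij_betw g (elts b) X"
    and giso: "\<And>x y. x \<in> elts b \<Longrightarrow> y \<in> elts b \<Longrightarrow> x \<in> elts y \<longleftrightarrow> g x \<in> elts (g y)" by blast
  let ?h = "inv_into (elts a) f \<circ> g"
  have fX: "inv_into (elts a) f y \<in> elts a" "f (inv_into (elts a) f y) = y" if "y \<in> X" for y
    using f that by (auto simp: bij_betw_def inv_into_into f_inv_into_f)
  have "bij_betw ?h (elts b) (elts a)"
    using bij_betw_trans[OF g bij_betw_inv_into[OF f]] .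
  moreover have "x \<in> elts y \<longleftrightarrow> ?h x \<in> elts (?h y)" if "x \<in> elts b" "y \<in> elts b" for x y
  proof -
    have "g x \<in> X" "g y \<in> X" using g that by (auto simp: bij_betw_def)
    then show ?thesis using giso[OF that] iso fX by simp
  qed
  ultimately show "b = a" using ordinal_iso_unique[OF b a] by blast
qed

subsection \<open>The Mostowski collapse\<close>

text \<open>The collapse is taken along an arbitrary well-founded relation: along membership it collapses
  elementary submodels, and along a well-ordering it yields the isomorphic ordinal.\<close>

definition collapse :: "('v \<times> 'v) set \<Rightarrow> 'v set \<Rightarrow> 'v::zfc \<Rightarrow> 'v" where
  "collapse R X = wfrec R (\<lambda>G x. vset (G ` {y \<in> X. (y, x) \<in> R}))"

lemma elts_collapse:
  assumes "wf R" "small X"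
  shows "elts (collapse R X x) = collapse R X ` {y \<in> X. (y, x) \<in> R}"
proof -
  have "collapse R X x = vset (cut (collapse R X) R x ` {y \<in> X. (y, x) \<in> R})"
    unfolding collapse_def by (subst wfrec[OF assms(1)]) simp
  also have "cut (collapse R X) R x ` {y \<in> X. (y, x) \<in> R} = collapse R X ` {y \<in> X. (y, x) \<in> R}"
    by (auto simp: cut_apply intro!: image_eqI)
  finally show ?thesis
    using small_image[OF small_subset[OF assms(2)]] by (simp add: elts_vset_small)
qed

text \<open>The well-ordering theorem of HOL followed by the collapse of the well-ordering, which is
  injective by linearity and has transitive values by transitivity.\<close>

lemma small_eqpoll_ordinal:
  fixes A :: "'v::zfc set"
  assumes "small A"
  obtains \<alpha> :: 'v where "ordinal \<alpha>" "A \<approx> elts \<alpha>"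
proof -
  obtain r where r: "well_order_on A r" using well_order_on by blast
  define R where "R = r - Id"
  have wfR: "wf R" using r unfolding well_order_on_def R_def by blast
  have lin: "linear_order_on A r" using r unfolding well_order_on_def by blast
  have RA: "R \<subseteq> A \<times> A"
    using lin unfolding R_def linear_order_on_def partial_order_on_def preorder_on_def refl_on_def
    by blast
  have tr: "(x, z) \<in> R" if "(x, y) \<in> R" "(y, z) \<in> R" for x y z
    using that lin wf_asym[OF wfR] unfolding R_def linear_order_on_def partial_order_on_def preorder_on_def trans_def
    by blast
  have tot: "(x, y) \<in> R \<or> x = y \<or> (y, x) \<in> R" if "x \<in> A" "y \<in> A" for x y
    using that lin unfolding R_def linear_order_on_def total_on_def by blast
  let ?G = "collapse R A"
  have G: "elts (?G x) = ?G ` {y. (y, x) \<in> R}" for x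
  proof -
    have "{y \<in> A. (y, x) \<in> R} = {y. (y, x) \<in> R}" using RA by blast
    then show ?thesis using elts_collapse[OF wfR assms, of x] by simp
  qed
  have sub: "transitive_set (?G x)" for x
    unfolding transitive_set_def using tr by (fastforce simp: G)
  have "ordinal (?G x)" for x
    unfolding ordinal_def using sub by (auto simp: G)
  moreover have "elts (?G x) \<subseteq> ?G ` A" for x
    using RA by (force simp: G)
  ultimately have "ordinal (vset (?G ` A))"
    by (intro ordinal_vset small_image[OF assms]) auto
  moreover have "inj_on ?G A"
  proof (rule inj_onI, rule ccontr)
    fix x y assume "x \<in> A" "y \<in> A" and eq: "?G x = ?G y" and "x \<noteq> y"
    then have "(x, y) \<in> R \<or> (y, x) \<in> R" using tot by blast
    then have "?G x \<in> elts (?G y) \<or> ?G y \<in> elts (?G x)" unfolding G by blast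
    then show False using eq mem_irrefl by metis
  qed
  then have "A \<approx> elts (vset (?G ` A))"
    using assms by (simp add: elts_vset_small small_image eqpoll_sym inj_on_image_eqpoll_self)
  ultimately show thesis using that by blast
qed

subsection \<open>Cardinals\<close>

lemma cardinal_ordinal: "cardinal k \<Longrightarrow> ordinal k"
  unfolding cardinal_def by blast

lemma cardinal_mem_iff:
  assumes "cardinal k" "ordinal a" shows "a \<in> elts k \<longleftrightarrow> elts a \<prec> elts k"
proof
  assume "elts a \<prec> elts k"
  then have "\<not> elts k \<subseteq> elts a"
    using lesspoll_trans2 subset_imp_lepoll lesspoll_not_refl by blast
  then show "a \<in> elts k"
    using assms ordinal_linear ordinal_subset cardinal_ordinal by blast
qed (use assms in \<open>auto simp: cardinal_def\<close>)

lemma cardinal_subset: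
  assumes "cardinal k" "ordinal a" "elts k \<lesssim> elts a" shows "elts k \<subseteq> elts a"
proof -
  have "a \<notin> elts k" using assms by (meson cardinal_def lesspoll_not_refl lesspoll_trans1)
  then show ?thesis using assms ordinal_linear ordinal_subset cardinal_ordinal by blast
qed

lemma Pow_lepoll_vpow: "Pow (elts x) \<lesssim> elts (vpow x)"
proof -
  have "inj_on vset (Pow (elts x))"
    by (metis (no_types, lifting) PowD elts_vset_subset inj_onI)
  moreover have "vset ` Pow (elts x) \<subseteq> elts (vpow x)"
    by (auto simp: elts_vpow elts_vset_subset)
  ultimately show ?thesis unfolding lepoll_def by blast
qed

text \<open>The least ordinal into which the power set injects is a cardinal, by minimality.\<close>

lemma exists_larger_cardinal:
  fixes A :: "'v::zfc set"
  assumes "small A"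
  obtains k :: 'v where "cardinal k" "A \<prec> elts k"
proof -
  obtain z where z: "elts z = A" using assms unfolding small_def by blast
  let ?S = "{k::'v. ordinal k \<and> elts (vpow z) \<lesssim> elts k}"
  obtain \<alpha> :: 'v where "ordinal \<alpha>" "elts (vpow z) \<approx> elts \<alpha>"
    by (rule small_eqpoll_ordinal[OF small_elts[of "vpow z"]])
  then have "\<alpha> \<in> ?S" by (simp add: eqpoll_imp_lepoll)
  then have "?S \<noteq> {}" by blast
  then obtain k where k: "k \<in> ?S" "\<And>x. x \<in> ?S \<Longrightarrow> elts k \<subseteq> elts x"
    by (rule ordinal_least[of ?S]) auto
  have "elts a \<prec> elts k" if a: "a \<in> elts k" for a
    unfolding lesspoll_def
  proof
    show "elts a \<lesssim> elts k" using ordinal_subset[OF _ a] k(1) subset_imp_lepoll by blast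
    show "\<not> elts a \<approx> elts k"
    proof
      assume "elts a \<approx> elts k"
      then have "elts (vpow z) \<lesssim> elts a"
        using k(1) lepoll_trans2[of "elts (vpow z)" "elts k" "elts a"] eqpoll_sym by blast
      then have "a \<in> ?S" using k(1) a ordinal_elt by blast
      then show False using k(2) a mem_irrefl by blast
    qed
  qed
  then have "cardinal k" using k(1) unfolding cardinal_def by blast
  moreover have "A \<prec> elts k"
  proof -
    have "Pow A \<lesssim> elts (vpow z)" using Pow_lepoll_vpow[of z] z by simp
    then have "A \<prec> elts (vpow z)" using lesspoll_Pow_self lesspoll_trans2 by blast
    then show ?thesis using k(1) lesspoll_trans2 by blast
  qed
  ultimately show thesis using that by blast
qed

subsection \<open>Hereditary cardinality\<close>

lemma trans_closure_least:
  assumes "\<And>y. y \<in> T \<Longrightarrow> elts y \<subseteq> T" "elts x \<subseteq> T"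
  shows "trans_closure x \<subseteq> T"
proof -
  have "(y, x) \<in> {(a, b). a \<in> elts b}\<^sup>+ \<Longrightarrow> y \<in> T" for y
    by (induction rule: converse_trancl_induct) (use assms in auto)
  then show ?thesis unfolding trans_closure_def by blast
qed

lemma elts_subset_trans_closure: "elts x \<subseteq> trans_closure x"
  unfolding trans_closure_def by auto

lemma trans_closure_closed: "y \<in> trans_closure x \<Longrightarrow> elts y \<subseteq> trans_closure x"
  unfolding trans_closure_def by (auto intro: trancl_into_trancl2)

lemma trans_closure_mono: "y \<in> elts x \<Longrightarrow> trans_closure y \<subseteq> trans_closure x"
  using elts_subset_trans_closure[of x] trans_closure_closed[of _ x]
  by (intro trans_closure_least) auto

lemma trans_closure_subset: "elts y \<subseteq> elts x \<Longrightarrow> trans_closure y \<subseteq> trans_closure x"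
  using elts_subset_trans_closure[of x] trans_closure_closed[of _ x]
  by (intro trans_closure_least) auto

lemma H_transitive: "x \<in> H \<theta> \<Longrightarrow> y \<in> elts x \<Longrightarrow> y \<in> H \<theta>"
  unfolding H_def using trans_closure_mono[of y x] lesspoll_trans1[OF subset_imp_lepoll] by blast

lemma H_subset: "x \<in> H \<theta> \<Longrightarrow> elts y \<subseteq> elts x \<Longrightarrow> y \<in> H \<theta>"
  unfolding H_def using trans_closure_subset[of y x] lesspoll_trans1[OF subset_imp_lepoll] by blast

text \<open>Membership in \<open>H \<theta>\<close> is shown by enclosing the elements of \<open>x\<close> in a transitive collection \<open>T\<close> that is
  small enough; \<open>x\<close> itself need not belong to \<open>T\<close>.\<close>

lemma H_intro:
  assumes "\<And>y. y \<in> T \<Longrightarrow> elts y \<subseteq> T" "elts x \<subseteq> T" "T \<prec> elts \<theta>"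
  shows "x \<in> H \<theta>"
  unfolding H_def using trans_closure_least[of T x] assms lesspoll_trans1[OF subset_imp_lepoll] by blast

lemma transitive_vpow: "transitive_set x \<Longrightarrow> transitive_set (vpow x)"
  unfolding transitive_set_def by (auto simp: elts_vpow)

lemma subset_vpow: "transitive_set x \<Longrightarrow> elts x \<subseteq> elts (vpow x)"
  unfolding transitive_set_def by (auto simp: elts_vpow)

lemma small_if_lesspoll: "A \<prec> elts (z::'v::zfc) \<Longrightarrow> small (A::'v set)"
  using small_lepoll lesspoll_imp_lepoll by blast

text \<open>The supremum of a sequence of cardinals with \<open>2\<^bsup>c k\<^esup> < c (k + 1)\<close> is a strong limit. If \<open>x \<in> H \<theta>\<close>, the
  transitive closure of \<open>x\<close> has size at most some \<open>c k\<close>, and the sets included in it form a transitive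
  collection of size less than \<open>\<theta>\<close> that contains the subsets of \<open>x\<close>.\<close>

lemma exists_strong_limit:
  fixes \<alpha> :: "'v::zfc"
  assumes "ordinal \<alpha>"
  obtains \<theta> :: 'v where "cardinal \<theta>" "\<alpha> \<in> elts \<theta>" "\<And>x. x \<in> H \<theta> \<Longrightarrow> vpow x \<in> H \<theta>"
proof -
  have ex: "\<exists>k::'v. cardinal k \<and> elts (vpow x) \<prec> elts k" for x :: 'v
    using exists_larger_cardinal[OF small_elts[of "vpow x"]] by metis
  define nxt where "nxt x = (SOME k::'v. cardinal k \<and> elts (vpow x) \<prec> elts k)" for x :: 'v
  have nxt: "cardinal (nxt x)" "elts (vpow x) \<prec> elts (nxt x)" for x
    unfolding nxt_def using someI_ex[OF ex[of x]] by auto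
  \<comment> \<open>Starting with \<open>nxt \<alpha>\<close> and not with \<open>\<alpha>\<close> makes every member a cardinal above \<open>\<alpha>\<close>.\<close>
  define c where "c k = (nxt ^^ Suc k) \<alpha>" for k
  have c_Suc: "c (Suc k) = nxt (c k)" for k unfolding c_def by simp
  have c_card: "cardinal (c k)" for k unfolding c_def using nxt by simp
  have self_nxt: "elts x \<prec> elts (nxt x)" for x
    using lesspoll_trans[OF lesspoll_trans2[OF lesspoll_Pow_self Pow_lepoll_vpow] nxt(2)] .
  have step: "c k \<in> elts (c (Suc k))" for k
    using cardinal_mem_iff[OF c_card cardinal_ordinal[OF c_card]] self_nxt c_Suc by metis
  have \<alpha>: "\<alpha> \<in> elts (c 0)"
    using cardinal_mem_iff[OF c_card assms, of 0] self_nxt[of \<alpha>] unfolding c_def by simp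
  define \<theta> where "\<theta> = vset (\<Union>k. elts (c k))"
  have el: "elts \<theta> = (\<Union>k. elts (c k))"
    unfolding \<theta>_def using small_UN[OF small_range_nat[of c], of elts]
    by (simp add: elts_vset_small)
  then have mem: "x \<in> elts \<theta> \<longleftrightarrow> (\<exists>k. x \<in> elts (c k))" for x by simp
  have ord: "ordinal \<theta>"
  proof -
    have "ordinal (vset (elts \<theta>))"
    proof (rule ordinal_vset)
      fix x assume "x \<in> elts \<theta>"
      then obtain k where "x \<in> elts (c k)" unfolding mem by blast
      then show "ordinal x" "elts x \<subseteq> elts \<theta>"
        using ordinal_elt[OF cardinal_ordinal[OF c_card]]
          ordinal_subset[OF cardinal_ordinal[OF c_card], of x k] by (auto simp: mem subset_iff)
    qed simp
    then show ?thesis by simp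
  qed
  have "elts a \<prec> elts \<theta>" if a: "a \<in> elts \<theta>" for a
  proof -
    obtain k where "a \<in> elts (c k)" using a unfolding mem by blast
    then have "elts a \<prec> elts (c k)" using c_card unfolding cardinal_def by blast
    also have "elts (c k) \<lesssim> elts \<theta>" by (intro subset_imp_lepoll) (auto simp: mem)
    finally show ?thesis .
  qed
  then have card: "cardinal \<theta>" using ord unfolding cardinal_def by blast
  have "vpow x \<in> H \<theta>" if x: "x \<in> H \<theta>" for x
  proof -
    have "trans_closure x \<prec> elts \<theta>" using x unfolding H_def by simp
    then have "small (trans_closure x)" by (rule small_if_lesspoll)
    then obtain \<beta> :: 'v where \<beta>: "ordinal \<beta>" "trans_closure x \<approx> elts \<beta>"
      by (rule small_eqpoll_ordinal)
    then have "\<beta> \<in> elts \<theta>"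
      using cardinal_mem_iff[OF card] \<open>trans_closure x \<prec> elts \<theta>\<close>
        eq_lesspoll_trans[OF eqpoll_sym] by blast
    then obtain k where "\<beta> \<in> elts (c k)" unfolding mem by blast
    then have "elts \<beta> \<prec> elts (c k)" using c_card unfolding cardinal_def by blast
    then have "trans_closure x \<lesssim> elts (c k)"
      using lepoll_trans1[OF \<beta>(2)] lesspoll_imp_lepoll by blast
    then obtain f where "inj_on f (trans_closure x)" "f ` trans_closure x \<subseteq> elts (c k)"
      unfolding lepoll_def by blast
    then have "inj_on ((`) f) (Pow (trans_closure x))" "(`) f ` Pow (trans_closure x) \<subseteq> Pow (elts (c k))"
      using inj_on_image_Pow image_Pow_mono by blast+
    then have le: "Pow (trans_closure x) \<lesssim> Pow (elts (c k))" unfolding lepoll_def by blast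
    let ?T = "{y. elts y \<subseteq> trans_closure x}"
    have "inj_on elts ?T" by (simp add: extensionality inj_on_def)
    then have "?T \<lesssim> Pow (trans_closure x)" unfolding lepoll_def by blast
    also note le
    also have "Pow (elts (c k)) \<lesssim> elts (vpow (c k))" by (rule Pow_lepoll_vpow)
    also have "elts (vpow (c k)) \<prec> elts (c (Suc k))" unfolding c_Suc by (rule nxt(2))
    also have "elts (c (Suc k)) \<lesssim> elts \<theta>" by (intro subset_imp_lepoll) (auto simp: mem)
    finally have T: "?T \<prec> elts \<theta>" .
    show ?thesis
    proof (rule H_intro[OF _ _ T])
      show "elts y \<subseteq> ?T" if "y \<in> ?T" for y
        using that trans_closure_closed by blast
      show "elts (vpow x) \<subseteq> ?T"
        using elts_subset_trans_closure[of x] by (auto simp: elts_vpow)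
    qed
  qed
  moreover have "\<alpha> \<in> elts \<theta>" using \<alpha> unfolding mem by blast
  ultimately show thesis using that card by blast
qed

section \<open>Formulas and elementarity\<close>

instance formula :: countable by countable_datatype

definition FEx :: "nat \<Rightarrow> formula \<Rightarrow> formula" where "FEx i \<phi> = FNot (FAll i (FNot \<phi>))"
definition FImp :: "formula \<Rightarrow> formula \<Rightarrow> formula" where "FImp \<phi> \<psi> = FNot (FAnd \<phi> (FNot \<psi>))"
definition FIff :: "formula \<Rightarrow> formula \<Rightarrow> formula" where "FIff \<phi> \<psi> = FAnd (FImp \<phi> \<psi>) (FImp \<psi> \<phi>)"
definition FOr :: "formula \<Rightarrow> formula \<Rightarrow> formula" where "FOr \<phi> \<psi> = FImp (FNot \<phi>) \<psi>"

lemma sat_derived [simp]: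
  "sat M e (FEx i \<phi>) \<longleftrightarrow> (\<exists>x\<in>M. sat M (e(i := x)) \<phi>)"
  "sat M e (FImp \<phi> \<psi>) \<longleftrightarrow> (sat M e \<phi> \<longrightarrow> sat M e \<psi>)"
  "sat M e (FIff \<phi> \<psi>) \<longleftrightarrow> (sat M e \<phi> \<longleftrightarrow> sat M e \<psi>)"
  "sat M e (FOr \<phi> \<psi>) \<longleftrightarrow> (sat M e \<phi> \<or> sat M e \<psi>)"
  unfolding FEx_def FImp_def FIff_def FOr_def by auto

text \<open>Only finitely many variables occur in a formula. This reduces an assignment to a finite list,
  on which a Skolem function can operate.\<close>

lemma sat_finite_support:
  "\<exists>K::nat. \<forall>e e'. (\<forall>k<K. e k = e' k) \<longrightarrow> (sat M e \<phi> \<longleftrightarrow> sat M e' \<phi>)"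
proof (induction \<phi>)
  case (FMem i k)
  show ?case by (rule exI[of _ "Suc (i + k)"]) auto
next
  case (FEq i k)
  show ?case by (rule exI[of _ "Suc (i + k)"]) auto
next
  case (FNot \<phi>)
  then show ?case by auto
next
  case (FAnd \<phi> \<psi>)
  then obtain K L where "\<forall>e e'. (\<forall>k<K. e k = e' k) \<longrightarrow> (sat M e \<phi> \<longleftrightarrow> sat M e' \<phi>)"
    "\<forall>e e'. (\<forall>k<L. e k = e' k) \<longrightarrow> (sat M e \<psi> \<longleftrightarrow> sat M e' \<psi>)" by blast
  then show ?case by (intro exI[of _ "K + L"]) (metis sat.simps(4) trans_less_add1 trans_less_add2)
next
  case (FAll i \<phi>)
  then obtain K where K: "\<And>e e'. (\<forall>k<K. e k = e' k) \<Longrightarrow> (sat M e \<phi> \<longleftrightarrow> sat M e' \<phi>)" by blast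
  have "sat M e (FAll i \<phi>) \<longleftrightarrow> sat M e' (FAll i \<phi>)" if "\<forall>k<K. e k = e' k" for e e'
  proof -
    have "sat M (e(i := x)) \<phi> \<longleftrightarrow> sat M (e'(i := x)) \<phi>" for x by (rule K) (simp add: that)
    then show ?thesis by simp
  qed
  then show ?case by blast
qed

lemma range_upd: "range e \<subseteq> N \<Longrightarrow> x \<in> N \<Longrightarrow> range (e(i := x)) \<subseteq> N"
  by (auto simp: image_subset_iff)

lemma sat_iso:
  assumes j: "j ` M = X" "inj_on j M"
    and mem: "\<And>x y. x \<in> M \<Longrightarrow> y \<in> M \<Longrightarrow> x \<in> elts y \<longleftrightarrow> j x \<in> elts (j y)"
    and e: "range e \<subseteq> M"
  shows "sat M e \<phi> \<longleftrightarrow> sat X (j \<circ> e) \<phi>"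
  using e
proof (induction \<phi> arbitrary: e)
  case (FEq i k)
  then show ?case using inj_onD[OF j(2), of "e i" "e k"] by auto
next
  case (FAll i \<phi>)
  have "sat M (e(i := x)) \<phi> \<longleftrightarrow> sat X ((j \<circ> e)(i := j x)) \<phi>" if "x \<in> M" for x
    using FAll.IH[OF range_upd[OF FAll.prems that, of i]] unfolding fun_upd_comp .
  then show ?case unfolding j(1)[symmetric] by (simp del: o_apply)
qed (use mem in \<open>auto simp: image_subset_iff\<close>)

text \<open>The Tarski--Vaught test. The witnesses are sought for truth in the larger class \<open>N\<close>, so that the
  quantifier case of the induction reduces to the induction hypothesis.\<close>

lemma tarski_vaught:
  assumes "X \<subseteq> N"
    and witness: "\<And>\<phi> i e x. range e \<subseteq> X \<Longrightarrow> x \<in> N \<Longrightarrow> sat N (e(i := x)) \<phi> \<Longrightarrow> \<exists>y\<in>X. sat N (e(i := y)) \<phi>"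
    and "range e \<subseteq> X"
  shows "sat X e \<phi> \<longleftrightarrow> sat N e \<phi>"
  using \<open>range e \<subseteq> X\<close>
proof (induction \<phi> arbitrary: e)
  case (FAll i \<phi>)
  have *: "sat X (e(i := x)) \<phi> \<longleftrightarrow> sat N (e(i := x)) \<phi>" if "x \<in> X" for x
    using FAll.IH[OF range_upd[OF FAll.prems that]] .
  have "\<forall>x\<in>N. sat N (e(i := x)) \<phi>" if "\<forall>x\<in>X. sat N (e(i := x)) \<phi>"
    using witness[OF FAll.prems, of _ i "FNot \<phi>"] that by auto
  then show ?case using * assms(1) by auto
qed auto

subsection \<open>Skolem hulls\<close>

text \<open>Terms, rather than a closure operator, because statements about all elements of a hull are
  proved one term at a time: each term has finitely many generators, so it arises from one of the
  countably many terms over \<^typ>\<open>nat\<close> by substituting a finite list of generators.\<close>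

datatype 'a skterm = Gen 'a | Param nat | Skolem formula nat "'a skterm list"

instance skterm :: (countable) countable by countable_datatype

text \<open>The list gives the values of the first variables and \<open>d\<close> those of all others; \<open>d\<close> also serves as the
  value where no witness exists.\<close>

definition skolem :: "'v::zfc set \<Rightarrow> 'v \<Rightarrow> formula \<Rightarrow> nat \<Rightarrow> 'v list \<Rightarrow> 'v" where
  "skolem N d \<phi> i vs = (let e = (\<lambda>k. if k < length vs then vs ! k else d) in
     if \<exists>x\<in>N. sat N (e(i := x)) \<phi> then SOME x. x \<in> N \<and> sat N (e(i := x)) \<phi> else d)"

primrec skeval :: "'v::zfc set \<Rightarrow> (nat \<Rightarrow> 'v) \<Rightarrow> 'v skterm \<Rightarrow> 'v" where
  "skeval N p (Gen a) = a"
| "skeval N p (Param i) = p i"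
| "skeval N p (Skolem \<phi> i ts) = skolem N (p 0) \<phi> i (map (skeval N p) ts)"

definition hull :: "'v::zfc set \<Rightarrow> (nat \<Rightarrow> 'v) \<Rightarrow> 'v set \<Rightarrow> 'v set" where
  "hull N p A = skeval N p ` {t. set_skterm t \<subseteq> A}"

lemma skolem_in: "d \<in> N \<Longrightarrow> skolem N d \<phi> i vs \<in> N"
  unfolding skolem_def Let_def by (auto intro: someI2_bex)

lemma skeval_in: "range p \<subseteq> N \<Longrightarrow> set_skterm t \<subseteq> N \<Longrightarrow> skeval N p t \<in> N"
proof (induction t)
  case (Skolem \<phi> i ts)
  then have "p 0 \<in> N" by blast
  then show ?case by (simp add: skolem_in)
qed auto

lemma hull_subset: "range p \<subseteq> N \<Longrightarrow> A \<subseteq> N \<Longrightarrow> hull N p A \<subseteq> N"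
  unfolding hull_def by (force intro: skeval_in)

lemma hull_gen: "a \<in> A \<Longrightarrow> a \<in> hull N p A"
  unfolding hull_def by (rule image_eqI[of _ _ "Gen a"]) auto

lemma hull_param: "p i \<in> hull N p A"
  unfolding hull_def by (rule image_eqI[of _ _ "Param i"]) auto

lemma hull_skolem:
  assumes "set vs \<subseteq> hull N p A" shows "skolem N (p 0) \<phi> i vs \<in> hull N p A"
proof -
  have "\<exists>t. set_skterm t \<subseteq> A \<and> skeval N p t = v" if "v \<in> set vs" for v
    using subsetD[OF assms that] unfolding hull_def by auto
  then obtain T where "\<forall>v\<in>set vs. set_skterm (T v) \<subseteq> A \<and> skeval N p (T v) = v"
    using bchoice[of "set vs" "\<lambda>v t. set_skterm t \<subseteq> A \<and> skeval N p t = v"] by blast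
  then have T: "\<And>v. v \<in> set vs \<Longrightarrow> set_skterm (T v) \<subseteq> A \<and> skeval N p (T v) = v" by blast
  have "map (skeval N p) (map T vs) = vs" using T by (simp add: map_idI)
  then have "skeval N p (Skolem \<phi> i (map T vs)) = skolem N (p 0) \<phi> i vs" by simp
  moreover have "set_skterm (Skolem \<phi> i (map T vs)) \<subseteq> A" using T by auto
  ultimately show ?thesis unfolding hull_def by (metis (mono_tags, lifting) imageI mem_Collect_eq)
qed

text \<open>An assignment in the hull can be cut off after the finitely many variables of the formula,
  so a witness is the value of a Skolem function at elements of the hull.\<close>

lemma hull_elementary:
  assumes "range p \<subseteq> N" "A \<subseteq> N" "range e \<subseteq> hull N p A"
  shows "sat (hull N p A) e \<phi> \<longleftrightarrow> sat N e \<phi>"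
proof (rule tarski_vaught[OF hull_subset[OF assms(1,2)] _ assms(3)])
  fix \<phi> i e x
  assume e: "range e \<subseteq> hull N p A" and x: "x \<in> N" "sat N (e(i := x)) \<phi>"
  obtain K where K': "\<forall>e e'. (\<forall>k<K. e k = e' k) \<longrightarrow> (sat N e \<phi> \<longleftrightarrow> sat N e' \<phi>)"
    using sat_finite_support[of N \<phi>] by (elim exE)
  have K: "sat N e \<phi> \<longleftrightarrow> sat N e' \<phi>" if "\<forall>k<K. e k = e' k" for e e' using K' that by blast
  let ?vs = "map e [0..<K]"
  let ?e = "\<lambda>k. if k < length ?vs then ?vs ! k else p 0"
  have eq: "sat N (?e(i := y)) \<phi> \<longleftrightarrow> sat N (e(i := y)) \<phi>" for y by (rule K) auto
  have "skolem N (p 0) \<phi> i ?vs = (SOME y. y \<in> N \<and> sat N (?e(i := y)) \<phi>)"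
    unfolding skolem_def Let_def using x eq[of x] by auto
  moreover have "sat N (?e(i := (SOME y. y \<in> N \<and> sat N (?e(i := y)) \<phi>))) \<phi>"
    using someI[of "\<lambda>y. y \<in> N \<and> sat N (?e(i := y)) \<phi>" x] x eq[of x] by blast
  ultimately have "sat N (e(i := skolem N (p 0) \<phi> i ?vs)) \<phi>" using eq by simp
  moreover have "set ?vs \<subseteq> hull N p A" using e by auto
  ultimately show "\<exists>y\<in>hull N p A. sat N (e(i := y)) \<phi>" using hull_skolem by blast
qed

lemma finite_set_skterm: "finite (set_skterm t)"
  by (induction t) auto

text \<open>The term \<open>s\<close> over \<^typ>\<open>nat\<close> names each generator by a position in the list \<open>l\<close>.\<close>

lemma skterm_shape:
  obtains l s where "set l = set_skterm t" "t = map_skterm (nth l) s"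
proof -
  obtain l where l: "set l = set_skterm t" using finite_list[OF finite_set_skterm[of t]] by blast
  define f where "f a = (SOME i. i < length l \<and> l ! i = a)" for a
  have "l ! f a = a" if "a \<in> set_skterm t" for a
    using someI_ex[of "\<lambda>i. i < length l \<and> l ! i = a"] that[folded l] unfolding f_def
    by (auto simp: in_set_conv_nth)
  then have "map_skterm (nth l) (map_skterm f t) = t"
    by (simp add: skterm.map_comp skterm.map_ident_strong)
  then show thesis using that[OF l, of "map_skterm f t"] by simp
qed

lemma lists_lepoll_infinite:
  assumes "infinite A" shows "lists A \<lesssim> A"
proof -
  include cardinal_syntax
  have k: "{xs \<in> lists A. length xs = k} \<lesssim> A" for k
  proof (induction k)
    case 0
    have "{xs \<in> lists A. length xs = 0} = {[]}" by auto
    then show ?case using finite_lepoll_infinite[OF assms, of "{[]}"] by simp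
  next
    case (Suc k)
    have "{xs \<in> lists A. length xs = Suc k} \<subseteq> (\<lambda>(x, xs). x # xs) ` (A \<times> {xs \<in> lists A. length xs = k})"
      by (force simp: length_Suc_conv)
    then have "{xs \<in> lists A. length xs = Suc k} \<lesssim> A \<times> {xs \<in> lists A. length xs = k}"
      by (rule subset_image_lepoll)
    also have "\<dots> \<lesssim> A \<times> A" by (intro times_lepoll_mono lepoll_refl Suc)
    also have "A \<times> A \<lesssim> A"
      using card_of_Times_same_infinite[OF assms] by (simp add: eqpoll_iff_card_of_ordIso eqpoll_imp_lepoll)
    finally show ?case .
  qed
  have le: "|B| \<le>o |A|" if "B \<lesssim> A" for B :: "'b set"
    using that unfolding lepoll_def by (simp add: card_of_ordLeq)
  have "|\<Union>k\<in>(UNIV::nat set). {xs \<in> lists A. length xs = k}| \<le>o |A|"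
    using assms k by (intro card_of_UNION_ordLeq_infinite) (auto simp: le infinite_le_lepoll[symmetric])
  moreover have "(\<Union>k\<in>(UNIV::nat set). {xs \<in> lists A. length xs = k}) = lists A" by auto
  ultimately show ?thesis unfolding lepoll_def using card_of_ordLeq by metis
qed

text \<open>An element of the hull is given by a term over \<^typ>\<open>nat\<close> and a list of generators, and there are no
  more lists over an infinite set than elements.\<close>

lemma hull_lepoll:
  assumes "infinite A" shows "hull N p A \<lesssim> A"
proof -
  have nat: "(UNIV :: nat set) \<lesssim> A" using assms infinite_le_lepoll by blast
  have "hull N p A \<subseteq> (\<lambda>(s, l). skeval N p (map_skterm (nth l) s)) ` ((UNIV :: nat skterm set) \<times> lists A)"
  proof
    fix x assume "x \<in> hull N p A"
    then obtain t where t: "set_skterm t \<subseteq> A" "x = skeval N p t" unfolding hull_def by blast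
    obtain l s where "set l = set_skterm t" "t = map_skterm (nth l) s" by (rule skterm_shape)
    then show "x \<in> (\<lambda>(s, l). skeval N p (map_skterm (nth l) s)) ` (UNIV \<times> lists A)"
      using t by (intro image_eqI[of _ _ "(s, l)"]) auto
  qed
  then have "hull N p A \<lesssim> (UNIV :: nat skterm set) \<times> lists A" by (rule subset_image_lepoll)
  also have "\<dots> \<lesssim> A \<times> A"
  proof (intro times_lepoll_mono lists_lepoll_infinite[OF assms])
    have "(UNIV :: nat skterm set) \<lesssim> (UNIV :: nat set)"
      unfolding lepoll_def by (rule exI[of _ to_nat]) simp
    then show "(UNIV :: nat skterm set) \<lesssim> A" using nat lepoll_trans by blast
  qed
  also have "A \<times> A \<lesssim> A"
    using card_of_Times_same_infinite[OF assms] by (simp add: eqpoll_iff_card_of_ordIso eqpoll_imp_lepoll)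
  finally show ?thesis .
qed

section \<open>Normal ultrafilters\<close>

locale normal_ultrafilter =
  fixes \<kappa> l :: "'v::zfc" and U :: "'v set set"
  assumes cardinal_k: "cardinal \<kappa>" and uncountable_k: "uncountable (elts \<kappa>)"
    and ordinal_l: "ordinal l" and k_mem_l: "\<kappa> \<in> elts l"
    and ultrafilter: "ultrafilter_on (elts (vpow l)) U"
    and complete: "kappa_complete \<kappa> U"
    and normal: "normal_on_vpow l U"
begin

text \<open>Almost all \<open>a\<close>, that is, a set of \<open>a \<subseteq> l\<close> in the ultrafilter.\<close>

definition ae :: "('v \<Rightarrow> bool) \<Rightarrow> bool" where
  "ae P \<longleftrightarrow> {a \<in> elts (vpow l). P a} \<in> U"

lemma ae_mono: "ae P \<Longrightarrow> (\<And>a. a \<in> elts (vpow l) \<Longrightarrow> P a \<Longrightarrow> Q a) \<Longrightarrow> ae Q"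
proof -
  assume "ae P" and PQ: "\<And>a. a \<in> elts (vpow l) \<Longrightarrow> P a \<Longrightarrow> Q a"
  moreover have "{a \<in> elts (vpow l). P a} \<subseteq> {a \<in> elts (vpow l). Q a}" using PQ by auto
  ultimately show "ae Q"
    using ultrafilter unfolding ultrafilter_on_def ae_def by (metis (no_types, lifting) mem_Collect_eq subsetI)
qed

lemma ae_conj: "ae P \<Longrightarrow> ae Q \<Longrightarrow> ae (\<lambda>a. P a \<and> Q a)"
proof -
  assume "ae P" "ae Q"
  then have "{a \<in> elts (vpow l). P a} \<inter> {a \<in> elts (vpow l). Q a} \<in> U"
    using ultrafilter unfolding ultrafilter_on_def ae_def by blast
  moreover have "{a \<in> elts (vpow l). P a} \<inter> {a \<in> elts (vpow l). Q a} = {a \<in> elts (vpow l). P a \<and> Q a}"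
    by blast
  ultimately show ?thesis unfolding ae_def by simp
qed

lemma ae_ex: "ae P \<Longrightarrow> \<exists>a\<in>elts (vpow l). P a"
proof (rule ccontr)
  assume "ae P" "\<not> (\<exists>a\<in>elts (vpow l). P a)"
  then have "{a \<in> elts (vpow l). P a} = ({} :: 'v set)" by blast
  then have "{} \<in> U" using \<open>ae P\<close> unfolding ae_def by metis
  then show False using ultrafilter unfolding ultrafilter_on_def by blast
qed

lemma ae_not: "\<not> ae P \<Longrightarrow> ae (\<lambda>a. \<not> P a)"
proof -
  assume "\<not> ae P"
  moreover have "elts (vpow l) - {a \<in> elts (vpow l). P a} = {a \<in> elts (vpow l). \<not> P a}" by blast
  moreover have "\<forall>X. X \<subseteq> elts (vpow l) \<longrightarrow> X \<in> U \<or> elts (vpow l) - X \<in> U"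
    using ultrafilter unfolding ultrafilter_on_def by (elim conjE)
  then have "{a \<in> elts (vpow l). P a} \<in> U \<or> elts (vpow l) - {a \<in> elts (vpow l). P a} \<in> U"
    by (metis (no_types, lifting) mem_Collect_eq subsetI)
  ultimately show ?thesis unfolding ae_def by simp
qed

lemma ae_True: "ae (\<lambda>a. True)"
  using ultrafilter unfolding ae_def ultrafilter_on_def by simp

lemma ae_fine: "\<alpha> \<in> elts l \<Longrightarrow> ae (\<lambda>a. \<alpha> \<in> elts a)"
  using normal unfolding normal_on_vpow_def ae_def by blast

lemma ae_All:
  assumes "I \<prec> elts \<kappa>" "\<And>i. i \<in> I \<Longrightarrow> ae (P i)"
  shows "ae (\<lambda>a. \<forall>i\<in>I. P i a)"
proof (cases "I = {}")
  case True
  then show ?thesis using ae_True by simp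
next
  case False
  let ?F = "(\<lambda>i. {a \<in> elts (vpow l). P i a}) ` I"
  have "?F \<prec> elts \<kappa>" using lesspoll_trans1[OF image_lepoll assms(1)] .
  moreover have "?F \<subseteq> U" using assms(2) unfolding ae_def by blast
  ultimately have "\<Inter>?F \<in> U" using complete False unfolding kappa_complete_def by blast
  moreover have "\<Inter>?F = {a \<in> elts (vpow l). \<forall>i\<in>I. P i a}" using False by auto
  ultimately show ?thesis unfolding ae_def by simp
qed

lemma countable_lesspoll_k: "countable I \<Longrightarrow> I \<prec> elts \<kappa>"
proof -
  assume I: "countable I"
  have "infinite (elts \<kappa>)" using uncountable_k countable_finite by blast
  then have "(UNIV :: nat set) \<lesssim> elts \<kappa>" using infinite_le_lepoll by blast
  moreover have "I \<lesssim> (UNIV :: nat set)" using I unfolding countable_def lepoll_def by auto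
  ultimately have "I \<lesssim> elts \<kappa>" using lepoll_trans by blast
  moreover have "\<not> I \<approx> elts \<kappa>" using countable_eqpoll[OF I eqpoll_sym] uncountable_k by blast
  ultimately show ?thesis unfolding lesspoll_def by blast
qed

lemma ae_countable:
  fixes P :: "'c::countable \<Rightarrow> 'v \<Rightarrow> bool"
  assumes "\<And>i. ae (P i)" shows "ae (\<lambda>a. \<forall>i. P i a)"
  using ae_All[OF countable_lesspoll_k, of UNIV P] assms by simp

text \<open>Closure under diagonal intersections: otherwise some function choosing, for almost all
  \<open>a\<close>, a counterexample \<open>\<alpha> \<in> a\<close> would be almost everywhere constant.\<close>

lemma ae_diagonal:
  assumes "\<And>\<alpha>. \<alpha> \<in> elts l \<Longrightarrow> ae (P \<alpha>)"
  shows "ae (\<lambda>a. \<forall>\<alpha>\<in>elts a. P \<alpha> a)"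
proof (rule ccontr)
  assume "\<not> ?thesis"
  then have neg: "ae (\<lambda>a. \<not> (\<forall>\<alpha>\<in>elts a. P \<alpha> a))" by (rule ae_not)
  define f where "f a = (if \<exists>\<alpha>\<in>elts a. \<not> P \<alpha> a then SOME \<alpha>. \<alpha> \<in> elts a \<and> \<not> P \<alpha> a else \<kappa>)" for a
  have f: "f a \<in> elts a \<and> \<not> P (f a) a" if "\<not> (\<forall>\<alpha>\<in>elts a. P \<alpha> a)" for a
    using that someI_ex[of "\<lambda>\<alpha>. \<alpha> \<in> elts a \<and> \<not> P \<alpha> a"] unfolding f_def by auto
  have "f a \<in> elts l" if "a \<in> elts (vpow l)" for a
  proof (cases "\<forall>\<alpha>\<in>elts a. P \<alpha> a")
    case True
    then show ?thesis using k_mem_l unfolding f_def by auto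
  next
    case False
    then show ?thesis using f[OF False] that by (auto simp: elts_vpow)
  qed
  then have "f \<in> elts (vpow l) \<rightarrow> elts l" by blast
  moreover have "{a \<in> elts (vpow l). f a \<in> elts a} \<in> U"
    using ae_mono[OF neg, of "\<lambda>a. f a \<in> elts a"] f unfolding ae_def by blast
  ultimately obtain \<alpha> where \<alpha>: "\<alpha> \<in> elts l" "ae (\<lambda>a. f a = \<alpha>)"
    using normal unfolding normal_on_vpow_def ae_def by blast
  show False
    using ae_ex[OF ae_conj[OF neg ae_conj[OF \<alpha>(2) assms[OF \<alpha>(1)]]]] f by blast
qed

text \<open>For each fixed length by iterated diagonal intersections, one for each entry of the list, and
  then for all lengths by countable completeness.\<close>

lemma ae_lists:
  assumes "\<And>xs. set xs \<subseteq> elts l \<Longrightarrow> ae (P xs)"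
  shows "ae (\<lambda>a. \<forall>xs. set xs \<subseteq> elts a \<longrightarrow> P xs a)"
proof -
  have "ae (\<lambda>a. \<forall>xs. set xs \<subseteq> elts a \<and> length xs = k \<longrightarrow> P xs a)" for k :: nat
    using assms
  proof (induction k arbitrary: P)
    case 0
    have "ae (P [])" using 0 by simp
    then show ?case by (rule ae_mono) simp
  next
    case (Suc k)
    have "ae (\<lambda>a. \<forall>x\<in>elts a. \<forall>xs. set xs \<subseteq> elts a \<and> length xs = k \<longrightarrow> P (x # xs) a)"
      by (rule ae_diagonal, rule Suc.IH, rule Suc.prems) simp
    then show ?case by (rule ae_mono) (auto simp: length_Suc_conv)
  qed
  then have "ae (\<lambda>a. \<forall>k. \<forall>xs. set xs \<subseteq> elts a \<and> length xs = k \<longrightarrow> P xs a)" by (rule ae_countable)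
  then show ?thesis by (rule ae_mono) blast
qed

text \<open>What holds almost everywhere for each Skolem term over \<open>l\<close> separately holds, for almost all \<open>a\<close>,
  for all Skolem terms over \<open>a\<close> at once. This replaces the theorem of Los for the ultrapower.\<close>

lemma ae_skterm:
  assumes "\<And>t. set_skterm t \<subseteq> elts l \<Longrightarrow> ae (P t)"
  shows "ae (\<lambda>a. \<forall>t. set_skterm t \<subseteq> elts a \<longrightarrow> P t a)"
proof -
  have "ae (\<lambda>a. \<forall>xs. set xs \<subseteq> elts a \<longrightarrow> set_skterm (map_skterm (nth xs) s) \<subseteq> elts l
      \<longrightarrow> P (map_skterm (nth xs) s) a)" for s
  proof (rule ae_lists)
    fix xs :: "'v list"
    show "ae (\<lambda>a. set_skterm (map_skterm (nth xs) s) \<subseteq> elts l \<longrightarrow> P (map_skterm (nth xs) s) a)"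
      using assms[of "map_skterm (nth xs) s"] ae_True
      by (cases "set_skterm (map_skterm (nth xs) s) \<subseteq> elts l") simp_all
  qed
  then have "ae (\<lambda>a. \<forall>s. \<forall>xs. set xs \<subseteq> elts a \<longrightarrow> set_skterm (map_skterm (nth xs) s) \<subseteq> elts l
      \<longrightarrow> P (map_skterm (nth xs) s) a)" by (rule ae_countable)
  then show ?thesis
  proof (rule ae_mono, intro allI impI)
    fix a t
    assume a: "a \<in> elts (vpow l)" and t: "set_skterm t \<subseteq> elts a"
      and *: "\<forall>s xs. set xs \<subseteq> elts a \<longrightarrow> set_skterm (map_skterm (nth xs) s) \<subseteq> elts l
        \<longrightarrow> P (map_skterm (nth xs) s) a"
    obtain xs s where "set xs = set_skterm t" "t = map_skterm (nth xs) s" by (rule skterm_shape)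
    then show "P t a" using * t a by (auto simp: elts_vpow)
  qed
qed

text \<open>By fineness and completeness almost all \<open>a\<close> include a given \<open>\<alpha> \<in> \<kappa>\<close>, and the diagonal intersection
  over \<open>\<alpha>\<close> makes \<open>a \<inter> \<kappa>\<close> an initial segment of \<open>\<kappa>\<close>.\<close>

lemma ae_initial_segment: "ae (\<lambda>a. \<forall>\<alpha>\<in>elts a. \<alpha> \<in> elts \<kappa> \<longrightarrow> elts \<alpha> \<subseteq> elts a)"
proof (rule ae_diagonal)
  fix \<alpha> assume "\<alpha> \<in> elts l"
  show "ae (\<lambda>a. \<alpha> \<in> elts \<kappa> \<longrightarrow> elts \<alpha> \<subseteq> elts a)"
  proof (cases "\<alpha> \<in> elts \<kappa>")
    case True
    then have "elts \<alpha> \<prec> elts \<kappa>" using cardinal_k unfolding cardinal_def by blast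
    moreover have "\<beta> \<in> elts l" if "\<beta> \<in> elts \<alpha>" for \<beta>
      using that True k_mem_l ordinal_l by (meson ordinal_transD)
    ultimately have "ae (\<lambda>a. \<forall>\<beta>\<in>elts \<alpha>. \<beta> \<in> elts a)" by (intro ae_All ae_fine)
    then show ?thesis by (rule ae_mono) blast
  next
    case False
    then show ?thesis using ae_True by simp
  qed
qed

end

section \<open>Small embeddings from hugeness\<close>

text \<open>A set-sized elementary submodel \<open>X\<close> of a transitive class \<open>N\<close>, its collapse \<open>col\<close> onto a transitive
  set \<open>M\<close>, and the embedding \<open>j\<close> of \<open>M\<close> into \<open>N\<close> that inverts the collapse.\<close>

locale elementary_sub =
  fixes N X :: "'v::zfc set"
  assumes N_transitive: "\<And>x y. x \<in> N \<Longrightarrow> y \<in> elts x \<Longrightarrow> y \<in> N"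
    and X_subset: "X \<subseteq> N" and small_X: "small X"
    and elementary: "\<And>e \<phi>. range e \<subseteq> X \<Longrightarrow> sat X e \<phi> \<longleftrightarrow> sat N e \<phi>"
begin

definition col :: "'v \<Rightarrow> 'v" where "col = collapse {(x, y). x \<in> elts y} X"
definition M :: 'v where "M = vset (col ` X)"
definition j :: "'v \<Rightarrow> 'v" where "j = inv_into X col"

lemma elts_col: "elts (col x) = col ` (elts x \<inter> X)"
proof -
  have "{y \<in> X. (y, x) \<in> {(x, y). x \<in> elts y}} = elts x \<inter> X" by auto
  then show ?thesis unfolding col_def using elts_collapse[OF foundation small_X, of x] by simp
qed

text \<open>Distinct sets have distinct elements in \<open>N\<close>, by transitivity, hence also in \<open>X\<close>, by elementarity.\<close>

lemma X_extensional:
  assumes "x \<in> X" "y \<in> X" "elts x \<inter> X = elts y \<inter> X"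
  shows "x = y"
proof -
  let ?\<phi> = "FAll 2 (FIff (FMem 2 0) (FMem 2 1))"
  let ?e = "(\<lambda>_. x)(1 := y)"
  have "range ?e \<subseteq> X" using assms by auto
  moreover have "sat X ?e ?\<phi>" using assms(3) by auto
  ultimately have "sat N ?e ?\<phi>" using elementary by blast
  then have "\<forall>z\<in>N. z \<in> elts x \<longleftrightarrow> z \<in> elts y" by simp
  moreover have "x \<in> N" "y \<in> N" using assms X_subset by auto
  ultimately show ?thesis using N_transitive by (intro extensionality) blast
qed

lemma inj_col: "inj_on col X"
proof -
  have "x \<in> X \<longrightarrow> (\<forall>y\<in>X. col x = col y \<longrightarrow> x = y)" for x
  proof (induction x rule: mem_induct)
    case (1 x)
    show ?case
    proof (intro impI ballI)
      fix y assume x: "x \<in> X" and y: "y \<in> X" and eq: "col x = col y"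
      then have im: "col ` (elts x \<inter> X) = col ` (elts y \<inter> X)" using elts_col by metis
      have "elts x \<inter> X = elts y \<inter> X"
      proof (intro equalityI subsetI)
        fix z assume z: "z \<in> elts x \<inter> X"
        then have "col z \<in> col ` (elts y \<inter> X)" using im by blast
        then obtain w where w: "w \<in> elts y \<inter> X" "col z = col w" by auto
        then have "z = w" using 1[of z] z by auto
        then show "z \<in> elts y \<inter> X" using w by simp
      next
        fix w assume w: "w \<in> elts y \<inter> X"
        then have "col w \<in> col ` (elts x \<inter> X)" using im by blast
        then obtain z where z: "z \<in> elts x \<inter> X" "col w = col z" by auto
        then have "z = w" using 1[of z] w by auto
        then show "w \<in> elts x \<inter> X" using z by simp
      qed
      then show "x = y" using X_extensional[OF x y] by blast
    qed
  qed
  then show ?thesis by (auto intro: inj_onI)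
qed

lemma col_mem_iff: "x \<in> X \<Longrightarrow> y \<in> X \<Longrightarrow> col x \<in> elts (col y) \<longleftrightarrow> x \<in> elts y"
  unfolding elts_col using inj_onD[OF inj_col] by auto

lemma elts_M: "elts M = col ` X"
  unfolding M_def by (simp add: elts_vset_small small_image small_X)

lemma transitive_M: "transitive_set M"
  unfolding transitive_set_def by (auto simp: elts_M elts_col)

lemma j_col: "x \<in> X \<Longrightarrow> j (col x) = x"
  unfolding j_def by (simp add: inj_col)

lemma j_bij: "j ` elts M = X" "inj_on j (elts M)"
  unfolding elts_M by (auto simp: j_col image_image intro!: inj_onI)

lemma elementary_j: "elementary_embedding (elts M) N j"
  unfolding elementary_embedding_def
proof (intro conjI allI impI)
  show "j \<in> elts M \<rightarrow> N" using X_subset by (auto simp: elts_M j_col)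
  fix \<phi> and e :: "nat \<Rightarrow> 'v" assume e: "range e \<subseteq> elts M"
  have "sat (elts M) e \<phi> \<longleftrightarrow> sat X (j \<circ> e) \<phi>"
    by (rule sat_iso[OF j_bij _ e]) (auto simp: elts_M j_col col_mem_iff)
  also have "range (j \<circ> e) \<subseteq> X" using e j_bij(1) by auto
  then have "sat X (j \<circ> e) \<phi> \<longleftrightarrow> sat N (j \<circ> e) \<phi>" by (rule elementary)
  finally show "sat (elts M) e \<phi> \<longleftrightarrow> sat N (j \<circ> e) \<phi>" .
qed

lemma ordinal_col: "ordinal x \<Longrightarrow> ordinal (col x)"
  unfolding ordinal_def transitive_set_def by (fastforce simp: elts_col)

text \<open>The hypotheses say that \<open>X \<inter> \<kappa>\<close> is an initial segment of \<open>\<kappa>\<close> and not all of \<open>\<kappa>\<close>: the collapse is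
  the identity on this segment and moves \<open>\<kappa>\<close> to it.\<close>

lemma crit_j:
  assumes k: "\<kappa> \<in> X" "ordinal \<kappa>" and below: "col \<kappa> \<in> elts \<kappa>"
    and seg: "\<And>\<xi>. \<xi> \<in> X \<Longrightarrow> \<xi> \<in> elts \<kappa> \<Longrightarrow> elts \<xi> \<subseteq> X"
  shows "crit (elts M) j = col \<kappa>" "nontrivial (elts M) j"
proof -
  have fixed: "\<xi> \<in> X \<longrightarrow> \<xi> \<in> elts \<kappa> \<longrightarrow> col \<xi> = \<xi>" for \<xi>
  proof (induction \<xi> rule: mem_induct)
    case (1 \<xi>)
    show ?case
    proof (intro impI extensionality)
      assume \<xi>: "\<xi> \<in> X" "\<xi> \<in> elts \<kappa>"
      then have "elts \<xi> \<subseteq> X" "elts \<xi> \<subseteq> elts \<kappa>"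
        using seg[OF \<xi>] ordinal_subset[OF k(2) \<xi>(2)] by simp_all
      then have "col y = y" if "y \<in> elts \<xi>" for y using 1 that by blast
      then show "elts (col \<xi>) = elts \<xi>" unfolding elts_col using \<open>elts \<xi> \<subseteq> X\<close> by force
    qed
  qed
  let ?P = "\<lambda>a. a \<in> moved_ordinals (elts M) j \<and> (\<forall>b\<in>moved_ordinals (elts M) j. elts a \<subseteq> elts b)"
  have moved: "col \<kappa> \<in> moved_ordinals (elts M) j"
    unfolding moved_ordinals_def using k below by (auto simp: elts_M j_col ordinal_col)
  then show "nontrivial (elts M) j" unfolding nontrivial_def by blast
  have least: "elts (col \<kappa>) \<subseteq> elts b" if "b \<in> moved_ordinals (elts M) j" for b
  proof (rule ccontr)
    assume "\<not> elts (col \<kappa>) \<subseteq> elts b"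
    moreover have b: "ordinal b" "b \<in> elts (j b)" using that unfolding moved_ordinals_def by auto
    ultimately have "b \<in> elts (col \<kappa>)"
      using ordinal_linear[of b "col \<kappa>"] ordinal_subset_iff[OF ordinal_col[OF k(2)] b(1)]
      by (auto simp: ordinal_col k)
    then obtain \<xi> where \<xi>: "b = col \<xi>" "\<xi> \<in> elts \<kappa>" "\<xi> \<in> X" unfolding elts_col by blast
    then have "j b = b" using fixed[of \<xi>] j_col[of \<xi>] by simp
    then show False using b mem_irrefl by metis
  qed
  show "crit (elts M) j = col \<kappa>"
    unfolding crit_def
  proof (rule the_equality)
    show "?P (col \<kappa>)" using moved least by blast
    fix a assume "?P a"
    then show "a = col \<kappa>" using moved least[of a] by (intro extensionality equalityI) blast+
  qed
qed

text \<open>Being a set of subsets of \<open>l\<close> means the same in \<open>M\<close>, \<open>X\<close> and \<open>N\<close>, though \<open>M\<close> and \<open>X\<close> lack most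
  subsets of \<open>l\<close>: the property is stated by a formula with \<open>l\<close> as its only parameter.\<close>

lemma col_subset_vpow_in:
  assumes l: "l \<in> X" and B: "B \<in> X"
  shows "elts (col B) \<subseteq> elts (vpow_in M (col l)) \<longleftrightarrow> elts B \<subseteq> elts (vpow l)"
proof -
  let ?\<phi> = "FAll 2 (FImp (FMem 2 1) (FAll 3 (FImp (FMem 3 2) (FMem 3 0))))"
  let ?e = "(\<lambda>_. l)(1 := B)"
  have e: "range ?e \<subseteq> X" using assms by auto
  have N: "l \<in> N" "B \<in> N" using assms X_subset by auto
  have sub: "elts (col C) \<subseteq> A \<longleftrightarrow> (\<forall>y\<in>X. y \<in> elts C \<longrightarrow> col y \<in> A)" for C A
    unfolding elts_col by blast
  have "elts (col B) \<subseteq> elts (vpow_in M (col l)) \<longleftrightarrow>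
      (\<forall>C\<in>X. C \<in> elts B \<longrightarrow> (\<forall>y\<in>X. y \<in> elts C \<longrightarrow> col y \<in> elts (col l)))"
    unfolding sub[of B] by (simp add: elts_vpow_in elts_M sub)
  also have "\<dots> \<longleftrightarrow> sat X ?e ?\<phi>" using l by (simp add: col_mem_iff)
  also have "\<dots> \<longleftrightarrow> sat N ?e ?\<phi>" using e by (rule elementary)
  also have "\<dots> \<longleftrightarrow> (\<forall>C\<in>N. C \<in> elts B \<longrightarrow> (\<forall>y\<in>N. y \<in> elts C \<longrightarrow> y \<in> elts l))" by simp
  also have "\<dots> \<longleftrightarrow> (\<forall>C\<in>elts B. \<forall>y\<in>elts C. y \<in> elts l)"
    using N_transitive[OF N(2)] N_transitive[OF N_transitive[OF N(2)]] by blast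
  also have "\<dots> \<longleftrightarrow> elts B \<subseteq> elts (vpow l)" by (auto simp: elts_vpow)
  finally show ?thesis .
qed

end

lemma subset_vpow2: "ordinal x \<Longrightarrow> elts x \<subseteq> elts (vpow (vpow x))"
  using subset_trans[OF subset_vpow subset_vpow[OF transitive_vpow]] ordinal_transitive by auto

text \<open>A witness to \<open>n\<close>-hugeness and a cardinal \<open>\<theta>\<close> above the power set of the power set of \<open>\<Lambda> n\<close>, so that
  \<open>H \<theta>\<close> has the ultrafilter as an element.\<close>

locale huge = normal_ultrafilter \<kappa> "\<Lambda> n" U
  for \<kappa> :: "'v::zfc" and \<Lambda> :: "nat \<Rightarrow> 'v" and n :: nat and U :: "'v set set" +
  fixes \<theta> :: 'v
  assumes L0: "\<Lambda> 0 = \<kappa>" and L_card: "\<And>i. i \<le> n \<Longrightarrow> cardinal (\<Lambda> i)"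
    and L_inc: "\<And>i. i < n \<Longrightarrow> \<Lambda> i \<in> elts (\<Lambda> (Suc i))"
    and L_otp: "\<And>i. i < n \<Longrightarrow> ae (\<lambda>a. otp (elts a \<inter> elts (\<Lambda> (Suc i))) = \<Lambda> i)"
    and n_pos: "0 < n"
    and cardinal_theta: "cardinal \<theta>" and theta_large: "elts (vpow (vpow (\<Lambda> n))) \<prec> elts \<theta>"
begin

definition U_code :: 'v where "U_code = vset (vset ` U)"
text \<open>The parameters of the Skolem hulls are the cardinals \<open>\<Lambda> i\<close>, and the ultrafilter as a set at every
  index above \<open>n\<close>.\<close>

definition p :: "nat \<Rightarrow> 'v" where "p i = (if i \<le> n then \<Lambda> i else U_code)"

lemma mem_U_code: assumes "elts B \<subseteq> elts (vpow (\<Lambda> n))" shows "B \<in> elts U_code \<longleftrightarrow> elts B \<in> U"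
  and U_code_subset: "elts U_code \<subseteq> elts (vpow (vpow (\<Lambda> n)))"
proof -
  have U: "X \<subseteq> elts (vpow (\<Lambda> n))" if "X \<in> U" for X
    using ultrafilter that unfolding ultrafilter_on_def by blast
  then have "elts (vset X) \<subseteq> elts (vpow (\<Lambda> n))" if "X \<in> U" for X
    using that elts_vset_subset[of X "vpow (\<Lambda> n)"] by simp
  then have sub: "vset ` U \<subseteq> elts (vpow (vpow (\<Lambda> n)))"
    unfolding elts_vpow[of "vpow (\<Lambda> n)"] by blast
  then have U_code: "elts U_code = vset ` U" unfolding U_code_def by (rule elts_vset_subset)
  then show "elts U_code \<subseteq> elts (vpow (vpow (\<Lambda> n)))" using sub by simp
  show "B \<in> elts U_code \<longleftrightarrow> elts B \<in> U"
  proof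
    assume "B \<in> elts U_code"
    then obtain X where "X \<in> U" "B = vset X" using U_code by blast
    then show "elts B \<in> U" using U[of X] by (simp add: elts_vset_subset)
  next
    assume "elts B \<in> U"
    then have "vset (elts B) \<in> elts U_code" using U_code by blast
    then show "B \<in> elts U_code" by simp
  qed
qed

lemma L_subset: "i \<le> n \<Longrightarrow> elts (\<Lambda> i) \<subseteq> elts (\<Lambda> n)"
proof (induction "n - i" arbitrary: i)
  case (Suc m)
  then have "i < n" "m = n - Suc i" "Suc i \<le> n" by auto
  then show ?case
    using Suc(1)[of "Suc i"] L_inc[of i] ordinal_subset[OF cardinal_ordinal[OF L_card[of "Suc i"]]] by blast
qed auto

lemma p_range: "range p \<subseteq> H \<theta>"
proof -
  have tr: "transitive_set (vpow (vpow (\<Lambda> n)))"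
    by (intro transitive_vpow ordinal_transitive ordinal_l)
  have "elts (\<Lambda> n) \<subseteq> elts (vpow (vpow (\<Lambda> n)))"
    using subset_vpow2[OF ordinal_l] .
  then have "elts (p i) \<subseteq> elts (vpow (vpow (\<Lambda> n)))" for i
    using L_subset[of i] U_code_subset unfolding p_def by auto
  then have "p i \<in> H \<theta>" for i
    using tr by (intro H_intro[OF _ _ theta_large]) (auto simp: transitive_set_def)
  then show ?thesis by blast
qed

lemma L_mem_H: "i \<le> n \<Longrightarrow> \<Lambda> i \<in> H \<theta>"
  using subsetD[OF p_range rangeI[of p i]] by (simp add: p_def)

text \<open>The requirements on \<open>a\<close>, where \<open>X\<close> is the Skolem hull of \<open>a\<close>: \<open>X\<close> contains no elements of \<open>\<Lambda> n\<close> besides those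
  of \<open>a\<close>; among the sets of subsets of \<open>\<Lambda> n\<close> in \<open>X\<close>, the members of the ultrafilter are those that
  contain \<open>a\<close>; \<open>a \<inter> \<kappa>\<close> is an initial segment of \<open>\<kappa>\<close>; and \<open>a \<inter> \<Lambda> (i + 1)\<close> has order type \<open>\<Lambda> i\<close>.\<close>

definition good :: "'v \<Rightarrow> bool" where
  "good a \<longleftrightarrow>
     (\<forall>t. set_skterm t \<subseteq> elts a \<longrightarrow>
        (skeval (H \<theta>) p t \<in> elts (\<Lambda> n) \<longrightarrow> skeval (H \<theta>) p t \<in> elts a) \<and>
        (elts (skeval (H \<theta>) p t) \<subseteq> elts (vpow (\<Lambda> n)) \<longrightarrow>
           (a \<in> elts (skeval (H \<theta>) p t) \<longleftrightarrow> skeval (H \<theta>) p t \<in> elts U_code))) \<and>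
     (\<forall>\<alpha>\<in>elts a. \<alpha> \<in> elts \<kappa> \<longrightarrow> elts \<alpha> \<subseteq> elts a) \<and>
     (\<forall>i. i < n \<longrightarrow> otp (elts a \<inter> elts (\<Lambda> (Suc i))) = \<Lambda> i)"

lemma ae_good: "ae good"
  unfolding good_def
proof (intro ae_conj ae_skterm ae_initial_segment ae_countable)
  fix t :: "'v skterm"
  let ?B = "skeval (H \<theta>) p t"
  show "ae (\<lambda>a. ?B \<in> elts (\<Lambda> n) \<longrightarrow> ?B \<in> elts a)"
    using ae_fine[of ?B] ae_True by (cases "?B \<in> elts (\<Lambda> n)") simp_all
  show "ae (\<lambda>a. elts ?B \<subseteq> elts (vpow (\<Lambda> n)) \<longrightarrow> (a \<in> elts ?B \<longleftrightarrow> ?B \<in> elts U_code))"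
  proof (cases "elts ?B \<subseteq> elts (vpow (\<Lambda> n))")
    case True
    then have "{a \<in> elts (vpow (\<Lambda> n)). a \<in> elts ?B} = elts ?B" by blast
    then have "ae (\<lambda>a. a \<in> elts ?B) \<longleftrightarrow> ?B \<in> elts U_code" unfolding ae_def using mem_U_code[OF True] by simp
    then show ?thesis using ae_not[of "\<lambda>a. a \<in> elts ?B"] True by (cases "?B \<in> elts U_code") simp_all
  next
    case False
    then show ?thesis using ae_True by simp
  qed
next
  fix i
  show "ae (\<lambda>a. i < n \<longrightarrow> otp (elts a \<inter> elts (\<Lambda> (Suc i))) = \<Lambda> i)"
    using L_otp[of i] ae_True by (cases "i < n") simp_all
qed

text \<open>Take a good \<open>a\<close>, the collapse \<open>M\<close> of its Skolem hull \<open>X\<close>, and the inverse \<open>j\<close> of the collapse. As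
  \<open>X \<inter> \<Lambda> (i + 1) = a \<inter> \<Lambda> (i + 1)\<close> has order type \<open>\<Lambda> i\<close>, the collapse shifts the sequence \<open>\<Lambda>\<close> down by one,
  so the sequence of iterates of the critical point is \<open>col (\<Lambda> 0), \<Lambda> 0, \<Lambda> 1, \<dots>\<close>. Its \<open>n\<close>-th member is
  \<open>col (\<Lambda> n)\<close>, whose pointwise image under \<open>j\<close> is \<open>X \<inter> \<Lambda> n = a\<close>. Hence the set of all \<open>A\<close> with this image
  in \<open>j A\<close> is the collapse of the ultrafilter, which is an element of \<open>M\<close>.\<close>

lemma exists_small_embedding:
  "\<exists>M j. small_embedding \<kappa> \<theta> M j \<and>
        (\<forall>i\<le>n. (j ^^ i) (crit (elts M) j) \<in> elts M) \<and>
        vset {A \<in> elts (vpow_in M (vpow_in M ((j ^^ n) (crit (elts M) j)))).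
                vset (j ` elts ((j ^^ n) (crit (elts M) j))) \<in> elts (j A)} \<in> elts M"
proof -
  obtain a where a_sub: "elts a \<subseteq> elts (\<Lambda> n)" and good: "good a"
    using ae_ex[OF ae_good] by (auto simp: elts_vpow)
  define X where "X = hull (H \<theta>) p (elts a)"
  have l_H: "elts (\<Lambda> n) \<subseteq> H \<theta>" using L_mem_H[of n] H_transitive by blast
  have "hull (H \<theta>) p (elts a) \<subseteq> hull (H \<theta>) p (elts (\<Lambda> n))"
    unfolding hull_def using a_sub by blast
  moreover have "uncountable (elts (\<Lambda> n))"
    using L_subset[of 0] L0 uncountable_k countable_subset by auto
  then have "infinite (elts (\<Lambda> n))" using countable_finite by blast
  ultimately have X_le: "X \<lesssim> elts (\<Lambda> n)"
    unfolding X_def using hull_lepoll subset_imp_lepoll lepoll_trans by metis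
  interpret elementary_sub "H \<theta>" X
  proof
    show "small X" using X_le by (rule small_lepoll)
    show "X \<subseteq> H \<theta>" unfolding X_def using hull_subset[OF p_range] a_sub l_H by blast
    show "y \<in> H \<theta>" if "x \<in> H \<theta>" "y \<in> elts x" for x y using H_transitive that by blast
    show "sat X e \<phi> = sat (H \<theta>) e \<phi>" if "range e \<subseteq> X" for e \<phi>
      using hull_elementary[OF p_range _ that[unfolded X_def]] a_sub l_H unfolding X_def by blast
  qed
  have X_l: "X \<inter> elts (\<Lambda> n) = elts a"
  proof (intro equalityI subsetI)
    fix x assume "x \<in> X \<inter> elts (\<Lambda> n)"
    then show "x \<in> elts a" using good unfolding X_def hull_def good_def by blast
  next
    fix x assume "x \<in> elts a"
    then show "x \<in> X \<inter> elts (\<Lambda> n)" using a_sub unfolding X_def by (auto intro: hull_gen)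
  qed
  have U_X: "a \<in> elts B \<longleftrightarrow> B \<in> elts U_code" if "B \<in> X" "elts B \<subseteq> elts (vpow (\<Lambda> n))" for B
    using good that unfolding X_def hull_def good_def by blast
  have L_X: "\<Lambda> i \<in> X" if "i \<le> n" for i
    using hull_param[of p i] that unfolding X_def p_def by auto
  have U_code_X: "U_code \<in> X" using hull_param[of p "Suc n"] unfolding X_def p_def by auto
  have col_L: "col (\<Lambda> (Suc i)) = \<Lambda> i" if i: "i < n" for i
  proof -
    have eq: "elts (\<Lambda> (Suc i)) \<inter> X = elts a \<inter> elts (\<Lambda> (Suc i))"
      using L_subset[of "Suc i"] i X_l by auto
    have "otp (elts (\<Lambda> (Suc i)) \<inter> X) = col (\<Lambda> (Suc i))"
    proof (rule otp_eq)
      show "ordinal (col (\<Lambda> (Suc i)))" using i L_card by (intro ordinal_col cardinal_ordinal) auto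
      show "bij_betw j (elts (col (\<Lambda> (Suc i)))) (elts (\<Lambda> (Suc i)) \<inter> X)"
        unfolding bij_betw_def elts_col by (auto simp: j_col image_image intro!: inj_onI)
      show "x \<in> elts y \<longleftrightarrow> j x \<in> elts (j y)"
        if "x \<in> elts (col (\<Lambda> (Suc i)))" "y \<in> elts (col (\<Lambda> (Suc i)))" for x y
        using that unfolding elts_col[of "\<Lambda> (Suc i)"] by (auto simp: j_col col_mem_iff)
    qed
    then show ?thesis using good i unfolding eq good_def by simp
  qed
  have k: "\<kappa> \<in> X" "ordinal \<kappa>" using L_X[of 0] L0 cardinal_k cardinal_ordinal by auto
  \<comment> \<open>From \<open>\<kappa> \<in> \<Lambda> 1\<close> it follows that \<open>col \<kappa> \<in> col (\<Lambda> 1) = \<Lambda> 0 = \<kappa>\<close>.\<close>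
  have "\<kappa> \<in> elts (\<Lambda> (Suc 0))" using L_inc[OF n_pos] L0 by simp
  then have "col \<kappa> \<in> elts (col (\<Lambda> (Suc 0)))" using k(1) L_X[of "Suc 0"] n_pos by (simp add: col_mem_iff)
  then have below: "col \<kappa> \<in> elts \<kappa>" using col_L[OF n_pos] L0 by simp
  have seg: "elts \<xi> \<subseteq> X" if "\<xi> \<in> X" "\<xi> \<in> elts \<kappa>" for \<xi>
  proof -
    have "\<xi> \<in> elts a" using that X_l L_subset[of 0] L0 by auto
    then have "elts \<xi> \<subseteq> elts a" using good that(2) unfolding good_def by blast
    then show ?thesis using X_l by blast
  qed
  note crit = crit_j[OF k below seg]
  have M_H: "M \<in> H \<theta>"
  proof (rule H_intro)
    show "elts y \<subseteq> elts M" if "y \<in> elts M" for y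
      using transitive_M that unfolding transitive_set_def by blast
    have "elts M \<lesssim> X" unfolding elts_M by (rule image_lepoll)
    also note X_le
    also have "elts (\<Lambda> n) \<subseteq> elts (vpow (vpow (\<Lambda> n)))"
      using subset_vpow2[OF ordinal_l] .
    then have "elts (\<Lambda> n) \<lesssim> elts (vpow (vpow (\<Lambda> n)))" by (rule subset_imp_lepoll)
    also note theta_large
    finally show "elts M \<prec> elts \<theta>" .
  qed simp
  have k_theta: "\<kappa> \<in> elts \<theta>"
  proof -
    have "elts \<kappa> \<subseteq> elts (vpow (vpow (\<Lambda> n)))"
      using subset_vpow2[OF ordinal_l] L_subset[of 0] L0 by auto
    then have "elts \<kappa> \<prec> elts \<theta>" using theta_large lesspoll_trans1[OF subset_imp_lepoll] by blast
    then show ?thesis using cardinal_mem_iff[OF cardinal_theta k(2)] by blast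
  qed
  have small: "small_embedding \<kappa> \<theta> M j"
    unfolding small_embedding_def
    using cardinal_k cardinal_theta k_theta M_H transitive_M elementary_j crit j_col[OF k(1)] by simp
  have iter: "(j ^^ i) (crit (elts M) j) = col (\<Lambda> i)" if "i \<le> n" for i
    using that
  proof (induction i)
    case 0
    show ?case using crit L0 by simp
  next
    case (Suc i)
    then have "(j ^^ Suc i) (crit (elts M) j) = j (col (\<Lambda> i))" by simp
    also have "\<dots> = col (\<Lambda> (Suc i))" using Suc.prems L_X[of i] col_L[of i] by (simp add: j_col)
    finally show ?case .
  qed
  have j_l: "vset (j ` elts (col (\<Lambda> n))) = a"
  proof -
    have "j ` elts (col (\<Lambda> n)) = elts a" unfolding elts_col X_l[symmetric]
      by (auto simp: j_col image_image)
    then show ?thesis by simp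
  qed
  have "{A \<in> elts (vpow_in M (vpow_in M (col (\<Lambda> n)))). a \<in> elts (j A)} = elts (col U_code)"
  proof (intro equalityI subsetI)
    fix A assume A: "A \<in> {A \<in> elts (vpow_in M (vpow_in M (col (\<Lambda> n)))). a \<in> elts (j A)}"
    then obtain B where B: "B \<in> X" "A = col B" by (auto simp: elts_vpow_in elts_M)
    then have "elts B \<subseteq> elts (vpow (\<Lambda> n))"
      using A col_subset_vpow_in[OF L_X[of n] B(1)] by (simp add: elts_vpow_in[of M "vpow_in _ _"])
    then have "B \<in> elts U_code" using A B U_X by (simp add: j_col)
    then show "A \<in> elts (col U_code)" using B by (simp add: col_mem_iff U_code_X)
  next
    fix A assume "A \<in> elts (col U_code)"
    then obtain B where B: "B \<in> X" "A = col B" "B \<in> elts U_code" unfolding elts_col by blast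
    then have sub: "elts B \<subseteq> elts (vpow (\<Lambda> n))" using U_code_subset by (auto simp: elts_vpow[of "vpow _"])
    then have "elts A \<subseteq> elts (vpow_in M (col (\<Lambda> n)))"
      using B col_subset_vpow_in[OF L_X[of n] B(1)] by simp
    moreover have "A \<in> elts M" using B by (simp add: elts_M)
    moreover have "a \<in> elts (j A)" using B U_X[OF B(1) sub] by (simp add: j_col)
    ultimately show "A \<in> {A \<in> elts (vpow_in M (vpow_in M (col (\<Lambda> n)))). a \<in> elts (j A)}"
      by (simp add: elts_vpow_in[of M "vpow_in _ _"])
  qed
  then have "vset {A \<in> elts (vpow_in M (vpow_in M (col (\<Lambda> n)))). a \<in> elts (j A)} \<in> elts M"
    using U_code_X by (simp add: elts_M)
  moreover have "\<forall>i\<le>n. (j ^^ i) (crit (elts M) j) \<in> elts M"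
    using iter L_X by (simp add: elts_M)
  ultimately show ?thesis using small iter[of n] j_l by (intro exI[of _ M] exI[of _ j]) simp
qed

end

lemma n_huge_imp_small_embedding:
  fixes \<kappa> :: "'v::zfc"
  assumes "0 < n" "n_huge n \<kappa>"
  shows "for_all_sufficiently_large_cardinals \<kappa> (\<lambda>\<theta>.
      \<exists>M j. small_embedding \<kappa> \<theta> M j \<and>
        (\<forall>i\<le>n. (j ^^ i) (crit (elts M) j) \<in> elts M) \<and>
        vset {A \<in> elts (vpow_in M (vpow_in M ((j ^^ n) (crit (elts M) j)))).
                vset (j ` elts ((j ^^ n) (crit (elts M) j))) \<in> elts (j A)} \<in> elts M)"
proof -
  have k: "cardinal \<kappa>" "uncountable (elts \<kappa>)" using assms(2) unfolding n_huge_def by blast+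
  obtain \<Lambda> where L': "\<Lambda> 0 = \<kappa> \<and> (\<forall>i\<le>n. cardinal (\<Lambda> i)) \<and> (\<forall>i<n. \<Lambda> i \<in> elts (\<Lambda> (Suc i))) \<and>
        (\<exists>U. ultrafilter_on (elts (vpow (\<Lambda> n))) U \<and> kappa_complete \<kappa> U \<and> normal_on_vpow (\<Lambda> n) U \<and>
             (\<forall>i<n. {a \<in> elts (vpow (\<Lambda> n)). otp (elts a \<inter> elts (\<Lambda> (Suc i))) = \<Lambda> i} \<in> U))"
    using assms(2) unfolding n_huge_def by (elim conjE exE) (rule that, intro conjI exI)
  then have L: "\<Lambda> 0 = \<kappa>" "\<And>i. i \<le> n \<Longrightarrow> cardinal (\<Lambda> i)" "\<And>i. i < n \<Longrightarrow> \<Lambda> i \<in> elts (\<Lambda> (Suc i))"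
    by blast+
  obtain U where U: "ultrafilter_on (elts (vpow (\<Lambda> n))) U" "kappa_complete \<kappa> U"
      "normal_on_vpow (\<Lambda> n) U"
      "\<forall>i<n. {a \<in> elts (vpow (\<Lambda> n)). otp (elts a \<inter> elts (\<Lambda> (Suc i))) = \<Lambda> i} \<in> U"
    using L' by (elim conjE exE)
  have mem: "0 < i \<Longrightarrow> i \<le> n \<Longrightarrow> \<kappa> \<in> elts (\<Lambda> i)" for i
  proof (induction i)
    case (Suc i)
    show ?case
    proof (cases "i = 0")
      case True
      then show ?thesis using L Suc by auto
    next
      case False
      then have "\<kappa> \<in> elts (\<Lambda> i)" using Suc by simp
      then show ?thesis
        using ordinal_transD[OF cardinal_ordinal[OF L(2)[OF Suc.prems(2)]]] L(3)[of i] Suc.prems by simp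
    qed
  qed simp
  interpret normal_ultrafilter \<kappa> "\<Lambda> n" U
    by unfold_locales (use k U mem[of n] assms(1) cardinal_ordinal[OF L(2)[of n]] in simp_all)
  \<comment> \<open>Any ordinal as large as the double power set serves as the bound on \<open>\<theta>\<close>.\<close>
  obtain \<alpha> :: 'v where \<alpha>: "ordinal \<alpha>" "elts (vpow (vpow (\<Lambda> n))) \<approx> elts \<alpha>"
    by (rule small_eqpoll_ordinal[OF small_elts[of "vpow (vpow (\<Lambda> n))"]])
  have "elts (\<Lambda> n) \<subseteq> elts (vpow (vpow (\<Lambda> n)))"
    using subset_vpow2[OF ordinal_l] .
  then have "elts (\<Lambda> n) \<lesssim> elts \<alpha>" using lepoll_trans2[OF subset_imp_lepoll \<alpha>(2)] by blast
  then have "elts (\<Lambda> n) \<subseteq> elts \<alpha>" using cardinal_subset[OF L(2)[of n] \<alpha>(1)] by simp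
  then have "elts \<kappa> \<subseteq> elts \<alpha>" using ordinal_subset[OF ordinal_l k_mem_l] by blast
  moreover
  {
    fix \<theta> assume \<theta>: "cardinal \<theta>" "\<alpha> \<in> elts \<theta>"
    then have "elts \<alpha> \<prec> elts \<theta>" unfolding cardinal_def by blast
    then have large: "elts (vpow (vpow (\<Lambda> n))) \<prec> elts \<theta>" by (rule eq_lesspoll_trans[OF \<alpha>(2)])
    interpret huge \<kappa> \<Lambda> n U \<theta>
      by unfold_locales (use L U \<theta> large assms(1) in \<open>simp_all add: ae_def\<close>)
    note exists_small_embedding
  }
  ultimately show ?thesis
    unfolding for_all_sufficiently_large_cardinals_def using \<alpha>(1) by (intro exI[of _ \<alpha>]) blast
qed

section \<open>Formulas about transitive classes\<close>

text \<open>Apart from the bounded quantifiers, each derived formula below chooses its bound variables above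
  the variables that it receives, so no variable is captured and its meaning in a transitive class
  can be computed once and for all. Quantifiers bounded by a set range over its actual elements there, so such formulas are
  absolute.\<close>

definition trans_class :: "'v::zfc set \<Rightarrow> bool" where
  "trans_class N \<longleftrightarrow> (\<forall>x\<in>N. elts x \<subseteq> N)"

lemma trans_classD: "trans_class N \<Longrightarrow> x \<in> N \<Longrightarrow> y \<in> elts x \<Longrightarrow> y \<in> N"
  unfolding trans_class_def by blast

definition opair :: "'v::zfc \<Rightarrow> 'v \<Rightarrow> 'v" where
  "opair x y = vset {vset {x, x}, vset {x, y}}"

definition rel :: "'v::zfc \<Rightarrow> 'v \<Rightarrow> 'v \<Rightarrow> bool" where
  "rel f x y \<longleftrightarrow> opair x y \<in> elts f"

lemma elts_pair: "elts (vset {x, y}) = {x, y}"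
  using elts_vset_small[OF small_pair] .

lemma opair_iff: "z = opair x y \<longleftrightarrow> (\<exists>w w'. elts z = {w, w'} \<and> elts w = {x, x} \<and> elts w' = {x, y})"
proof
  assume "z = opair x y"
  then show "\<exists>w w'. elts z = {w, w'} \<and> elts w = {x, x} \<and> elts w' = {x, y}"
    unfolding opair_def using elts_pair by blast
next
  assume "\<exists>w w'. elts z = {w, w'} \<and> elts w = {x, x} \<and> elts w' = {x, y}"
  then obtain w w' where "elts z = {w, w'}" "elts w = {x, x}" "elts w' = {x, y}" by blast
  then show "z = opair x y"
    unfolding opair_def by (metis vset_elts)
qed

lemma vset_pair_iff: "vset {x, y} = vset {x', y'} \<longleftrightarrow> {x, y} = {x', y'}"
  using elts_pair by metis

lemma opair_inject: "opair x y = opair x' y' \<longleftrightarrow> x = x' \<and> y = y'"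
  unfolding opair_def vset_pair_iff doubleton_eq_iff by auto

definition fBall :: "nat \<Rightarrow> nat \<Rightarrow> formula \<Rightarrow> formula" where
  "fBall i k \<phi> = FAll i (FImp (FMem i k) \<phi>)"
definition fBex :: "nat \<Rightarrow> nat \<Rightarrow> formula \<Rightarrow> formula" where
  "fBex i k \<phi> = FEx i (FAnd (FMem i k) \<phi>)"

lemma sat_bounded:
  assumes "trans_class N" "e k \<in> N" "i \<noteq> k"
  shows "sat N e (fBall i k \<phi>) \<longleftrightarrow> (\<forall>x\<in>elts (e k). sat N (e(i := x)) \<phi>)"
    and "sat N e (fBex i k \<phi>) \<longleftrightarrow> (\<exists>x\<in>elts (e k). sat N (e(i := x)) \<phi>)"
  using assms trans_classD[OF assms(1,2)] unfolding fBall_def fBex_def by auto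

definition fSub :: "nat \<Rightarrow> nat \<Rightarrow> formula" where
  "fSub i k = fBall (Suc (i + k)) i (FMem (Suc (i + k)) k)"
definition fPairSet :: "nat \<Rightarrow> nat \<Rightarrow> nat \<Rightarrow> formula" where
  "fPairSet w x y = FAnd (FMem x w) (FAnd (FMem y w)
     (fBall (Suc (w + x + y)) w (FOr (FEq (Suc (w + x + y)) x) (FEq (Suc (w + x + y)) y))))"

lemma sat_fSub: "trans_class N \<Longrightarrow> e i \<in> N \<Longrightarrow> sat N e (fSub i k) \<longleftrightarrow> elts (e i) \<subseteq> elts (e k)"
  unfolding fSub_def by (auto simp: sat_bounded)

lemma sat_fPairSet: "trans_class N \<Longrightarrow> e w \<in> N \<Longrightarrow> sat N e (fPairSet w x y) \<longleftrightarrow> elts (e w) = {e x, e y}"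
  unfolding fPairSet_def by (auto simp: sat_bounded)

definition fOPair :: "nat \<Rightarrow> nat \<Rightarrow> nat \<Rightarrow> formula" where
  "fOPair z x y = (let w = Suc (z + x + y) in
     FEx w (FEx (Suc w) (FAnd (fPairSet z w (Suc w)) (FAnd (fPairSet w x x) (fPairSet (Suc w) x y)))))"
definition fRel :: "nat \<Rightarrow> nat \<Rightarrow> nat \<Rightarrow> formula" where
  "fRel f x y = fBex (Suc (f + x + y)) f (fOPair (Suc (f + x + y)) x y)"

lemma sat_fOPair:
  assumes "trans_class N" "e z \<in> N" shows "sat N e (fOPair z x y) \<longleftrightarrow> e z = opair (e x) (e y)"
proof -
  have "sat N e (fOPair z x y) \<longleftrightarrow>
      (\<exists>w\<in>N. \<exists>w'\<in>N. elts (e z) = {w, w'} \<and> elts w = {e x, e x} \<and> elts w' = {e x, e y})"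
    unfolding fOPair_def Let_def using assms by (simp add: sat_fPairSet)
  also have "\<dots> \<longleftrightarrow> (\<exists>w w'. elts (e z) = {w, w'} \<and> elts w = {e x, e x} \<and> elts w' = {e x, e y})"
    using trans_classD[OF assms] by blast
  finally show ?thesis unfolding opair_iff .
qed

lemma sat_fRel:
  assumes "trans_class N" "e f \<in> N" shows "sat N e (fRel f x y) \<longleftrightarrow> rel (e f) (e x) (e y)"
proof -
  have "sat N e (fRel f x y) \<longleftrightarrow> (\<exists>z\<in>elts (e f). sat N (e(Suc (f + x + y) := z)) (fOPair (Suc (f + x + y)) x y))"
    unfolding fRel_def by (subst sat_bounded) (use assms in auto)
  also have "\<dots> \<longleftrightarrow> (\<exists>z\<in>elts (e f). z = opair (e x) (e y))"
    using trans_classD[OF assms] by (intro bex_cong refl) (simp add: sat_fOPair assms)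
  finally show ?thesis unfolding rel_def by blast
qed

definition fTrans :: "nat \<Rightarrow> formula" where
  "fTrans x = fBall (Suc x) x (fSub (Suc x) x)"
definition fOrd :: "nat \<Rightarrow> formula" where
  "fOrd x = FAnd (fTrans x) (fBall (Suc x) x (fTrans (Suc x)))"

lemma sat_fTrans:
  assumes "trans_class N" "e x \<in> N" shows "sat N e (fTrans x) \<longleftrightarrow> transitive_set (e x)"
  unfolding fTrans_def transitive_set_def using assms trans_classD[OF assms]
  by (simp add: sat_bounded sat_fSub)

lemma sat_fOrd:
  assumes "trans_class N" "e x \<in> N" shows "sat N e (fOrd x) \<longleftrightarrow> ordinal (e x)"
  unfolding fOrd_def ordinal_def using assms trans_classD[OF assms]
  by (simp add: sat_bounded sat_fTrans)

text \<open>The relation coded by \<open>f\<close> is, when restricted to \<open>a\<close> and \<open>k\<close>, a partial function from \<open>a\<close> onto \<open>k\<close>.\<close>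

definition onto :: "'v::zfc \<Rightarrow> 'v \<Rightarrow> 'v \<Rightarrow> bool" where
  "onto f a k \<longleftrightarrow> (\<forall>y\<in>elts k. \<exists>x\<in>elts a. rel f x y) \<and>
     (\<forall>x\<in>elts a. \<forall>y\<in>elts k. \<forall>y'\<in>elts k. rel f x y \<and> rel f x y' \<longrightarrow> y = y')"

definition fOnto :: "nat \<Rightarrow> nat \<Rightarrow> nat \<Rightarrow> formula" where
  "fOnto f a k = (let m = Suc (f + a + k) in
     FAnd (fBall m k (fBex (Suc m) a (fRel f (Suc m) m)))
       (fBall m a (fBall (m + 1) k (fBall (m + 2) k
          (FImp (FAnd (fRel f m (m + 1)) (fRel f m (m + 2))) (FEq (m + 1) (m + 2)))))))"

lemma sat_fOnto:
  "trans_class N \<Longrightarrow> e f \<in> N \<Longrightarrow> e a \<in> N \<Longrightarrow> e k \<in> N \<Longrightarrow> sat N e (fOnto f a k) \<longleftrightarrow> onto (e f) (e a) (e k)"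
  unfolding fOnto_def onto_def Let_def by (simp add: sat_bounded sat_fRel)

definition fCard :: "nat \<Rightarrow> formula" where
  "fCard k = FAnd (fOrd k) (fBall (k + 1) k (FAll (k + 2) (FNot (fOnto (k + 2) (k + 1) k))))"

lemma sat_fCard:
  assumes "trans_class N" "e k \<in> N"
  shows "sat N e (fCard k) \<longleftrightarrow> ordinal (e k) \<and> (\<forall>a\<in>elts (e k). \<forall>f\<in>N. \<not> onto f a (e k))"
  unfolding fCard_def using assms trans_classD[OF assms]
  by (simp add: sat_bounded sat_fOrd sat_fOnto)

text \<open>The relation coded by \<open>f\<close> is an isomorphism from \<open>k\<close> to \<open>a \<inter> l\<close>.\<close>

definition otp_iso :: "'v::zfc \<Rightarrow> 'v \<Rightarrow> 'v \<Rightarrow> 'v \<Rightarrow> bool" where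
  "otp_iso f k a l \<longleftrightarrow> (\<forall>x\<in>elts k. \<exists>y\<in>elts a. y \<in> elts l \<and> rel f x y) \<and>
     (\<forall>y\<in>elts a. y \<in> elts l \<longrightarrow> (\<exists>x\<in>elts k. rel f x y)) \<and>
     (\<forall>x\<in>elts k. \<forall>x'\<in>elts k. \<forall>y\<in>elts a. \<forall>y'\<in>elts a. rel f x y \<and> rel f x' y' \<longrightarrow>
        (x \<in> elts x' \<longleftrightarrow> y \<in> elts y') \<and> (x = x' \<longleftrightarrow> y = y'))"

definition fIso :: "nat \<Rightarrow> nat \<Rightarrow> nat \<Rightarrow> nat \<Rightarrow> formula" where
  "fIso f k a l = (let m = Suc (f + k + a + l) in
     FAnd (fBall m k (fBex (m + 1) a (FAnd (FMem (m + 1) l) (fRel f m (m + 1)))))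
       (FAnd (fBall m a (FImp (FMem m l) (fBex (m + 1) k (fRel f (m + 1) m))))
         (fBall m k (fBall (m + 1) k (fBall (m + 2) a (fBall (m + 3) a
           (FImp (FAnd (fRel f m (m + 2)) (fRel f (m + 1) (m + 3)))
             (FAnd (FIff (FMem m (m + 1)) (FMem (m + 2) (m + 3)))
                (FIff (FEq m (m + 1)) (FEq (m + 2) (m + 3)))))))))))"

lemma sat_fIso:
  "trans_class N \<Longrightarrow> e f \<in> N \<Longrightarrow> e k \<in> N \<Longrightarrow> e a \<in> N \<Longrightarrow>
     sat N e (fIso f k a l) \<longleftrightarrow> otp_iso (e f) (e k) (e a) (e l)"
  unfolding fIso_def otp_iso_def Let_def by (simp add: sat_bounded sat_fRel)

lemma otp_iso_otp:
  assumes k: "ordinal k" and iso: "otp_iso f k a l"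
  shows "otp (elts a \<inter> elts l) = k"
proof -
  have "\<forall>x\<in>elts k. \<exists>y. y \<in> elts a \<and> y \<in> elts l \<and> rel f x y"
    using iso unfolding otp_iso_def by blast
  then obtain g where g: "\<And>x. x \<in> elts k \<Longrightarrow> g x \<in> elts a \<and> g x \<in> elts l \<and> rel f x (g x)"
    using bchoice[of "elts k" "\<lambda>x y. y \<in> elts a \<and> y \<in> elts l \<and> rel f x y"] by blast
  have *: "(x \<in> elts x' \<longleftrightarrow> y \<in> elts y') \<and> (x = x' \<longleftrightarrow> y = y')"
    if "x \<in> elts k" "x' \<in> elts k" "y \<in> elts a" "y' \<in> elts a" "rel f x y" "rel f x' y'" for x x' y y'
    using iso that unfolding otp_iso_def by blast
  have onto: "\<exists>x\<in>elts k. rel f x y" if "y \<in> elts a" "y \<in> elts l" for y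
    using iso that unfolding otp_iso_def by blast
  show ?thesis
  proof (rule otp_eq[OF k])
    show "bij_betw g (elts k) (elts a \<inter> elts l)"
      unfolding bij_betw_def
    proof (intro conjI equalityI subsetI inj_onI)
      fix x x' assume "x \<in> elts k" "x' \<in> elts k" "g x = g x'"
      then show "x = x'" using *[of x x' "g x" "g x'"] g[of x] g[of x'] by simp
    next
      fix y assume y: "y \<in> elts a \<inter> elts l"
      then obtain x where "x \<in> elts k" "rel f x y" using onto by blast
      then have "y = g x" using *[of x x y "g x"] g[of x] y by simp
      then show "y \<in> g ` elts k" using \<open>x \<in> elts k\<close> by blast
    next
      fix y assume "y \<in> g ` elts k"
      then show "y \<in> elts a \<inter> elts l" using g by blast
    qed
    fix x x' assume "x \<in> elts k" "x' \<in> elts k"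
    then show "x \<in> elts x' \<longleftrightarrow> g x \<in> elts (g x')" using *[of x x' "g x" "g x'"] g[of x] g[of x'] by simp
  qed
qed

lemma cardinal_no_onto: "cardinal k \<Longrightarrow> a \<in> elts k \<Longrightarrow> \<not> onto f a k"
proof
  assume "cardinal k" "a \<in> elts k" and f: "onto f a k"
  then have "elts a \<prec> elts k" unfolding cardinal_def by blast
  moreover have "elts k \<lesssim> elts a"
    using f unfolding onto_def by (intro lepoll_relational_full[of _ _ "rel f"]) blast+
  ultimately show False using lesspoll_trans1 lesspoll_not_refl by metis
qed

text \<open>Pairs of elements of \<open>T\<close> lie in the double power set of \<open>T\<close>, so closure under power sets gives a code
  in \<open>H \<theta>\<close> for every relation on \<open>T\<close>.\<close>

lemma exists_rel:
  assumes closed: "\<And>x. x \<in> H \<theta> \<Longrightarrow> vpow x \<in> H \<theta>" and T: "T \<in> H \<theta>"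
  shows "\<exists>f\<in>H \<theta>. \<forall>x y. rel f x y \<longleftrightarrow> x \<in> elts T \<and> y \<in> elts T \<and> P x y"
proof -
  let ?R = "{opair x y | x y. x \<in> elts T \<and> y \<in> elts T \<and> P x y}"
  have "opair x y \<in> elts (vpow (vpow T))" if "x \<in> elts T" "y \<in> elts T" for x y
    using that elts_pair[of x x] unfolding opair_def by (simp add: elts_vpow elts_pair)
  then have sub: "?R \<subseteq> elts (vpow (vpow T))" by blast
  then have R: "elts (vset ?R) = ?R" by (rule elts_vset_subset)
  have "vset ?R \<in> H \<theta>" using H_subset[OF closed[OF closed[OF T]], of "vset ?R"] sub R by simp
  moreover have "rel (vset ?R) x y \<longleftrightarrow> x \<in> elts T \<and> y \<in> elts T \<and> P x y" for x y
    unfolding rel_def R by (auto simp: opair_inject)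
  ultimately show ?thesis by blast
qed

lemma trans_class_H: "trans_class (H \<theta>)"
  unfolding trans_class_def using H_transitive by blast

text \<open>If \<open>H \<theta>\<close> is closed under power sets, it computes cardinals correctly.\<close>

lemma cardinal_if_no_onto:
  assumes closed: "\<And>x. x \<in> H \<theta> \<Longrightarrow> vpow x \<in> H \<theta>" and k: "k \<in> H \<theta>" "ordinal k"
    and no: "\<And>a f. a \<in> elts k \<Longrightarrow> f \<in> H \<theta> \<Longrightarrow> \<not> onto f a k"
  shows "cardinal k"
  unfolding cardinal_def
proof (intro conjI ballI k)
  fix a assume a: "a \<in> elts k"
  have "\<not> elts k \<lesssim> elts a"
  proof
    assume "elts k \<lesssim> elts a"
    then obtain g where g: "inj_on g (elts k)" "g ` elts k \<subseteq> elts a" unfolding lepoll_def by blast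
    obtain f where f: "f \<in> H \<theta>" "\<And>x y. rel f x y \<longleftrightarrow> x \<in> elts k \<and> y \<in> elts k \<and> x = g y"
      using exists_rel[OF closed k(1), where P = "\<lambda>x y. x = g y"] by blast
    have "elts a \<subseteq> elts k" using a k(2) ordinal_subset by blast
    then have "onto f a k" unfolding onto_def f(2) using g inj_onD[OF g(1)] by blast
    then show False using no a f by blast
  qed
  then show "elts a \<prec> elts k"
    using subset_imp_lepoll[OF ordinal_subset[OF k(2) a]] unfolding lesspoll_def
    by (meson eqpoll_imp_lepoll eqpoll_sym)
qed

section \<open>Hugeness from small embeddings\<close>

definition succ_of :: "'v::zfc \<Rightarrow> 'v \<Rightarrow> bool" where
  "succ_of x y \<longleftrightarrow> elts y = insert x (elts x)"

definition fSucc :: "nat \<Rightarrow> nat \<Rightarrow> formula" where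
  "fSucc x y = (let m = Suc (x + y) in
     FAnd (FMem x y) (FAnd (fSub x y) (fBall m y (FOr (FMem m x) (FEq m x)))))"

lemma sat_fSucc:
  "trans_class N \<Longrightarrow> e x \<in> N \<Longrightarrow> e y \<in> N \<Longrightarrow> sat N e (fSucc x y) \<longleftrightarrow> succ_of (e x) (e y)"
  unfolding fSucc_def succ_of_def Let_def by (auto simp: sat_bounded sat_fSub)

locale elementary_pair =
  fixes M :: "'v::zfc" and N :: "'v set" and j :: "'v \<Rightarrow> 'v"
  assumes M_transitive: "transitive_set M" and N_trans: "trans_class N"
    and embedding: "elementary_embedding (elts M) N j"
begin

lemma M_trans: "trans_class (elts M)"
  using M_transitive unfolding trans_class_def transitive_set_def by blast

lemma j_in: "x \<in> elts M \<Longrightarrow> j x \<in> N"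
  using embedding unfolding elementary_embedding_def by blast

lemma M_in: "x \<in> elts M \<Longrightarrow> y \<in> elts x \<Longrightarrow> y \<in> elts M"
  using trans_classD[OF M_trans] .

text \<open>Assignments with at most six distinct values suffice below. They go to the variables 0 and 2 to 6,
  because the simplifier turns the numeral 1 into \<open>Suc 0\<close>.\<close>

lemma transfer:
  assumes "x0 \<in> elts M" "x1 \<in> elts M" "x2 \<in> elts M" "x3 \<in> elts M" "x4 \<in> elts M" "x5 \<in> elts M"
  shows "sat (elts M) ((\<lambda>_::nat. x0)(2 := x1, 3 := x2, 4 := x3, 5 := x4, 6 := x5)) \<phi> \<longleftrightarrow>
    sat N ((\<lambda>_::nat. j x0)(2 := j x1, 3 := j x2, 4 := j x3, 5 := j x4, 6 := j x5)) \<phi>"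
proof -
  let ?e = "(\<lambda>_::nat. x0)(2 := x1, 3 := x2, 4 := x3, 5 := x4, 6 := x5)"
  have "range ?e \<subseteq> elts M" using assms by auto
  then have "sat (elts M) ?e \<phi> \<longleftrightarrow> sat N (j \<circ> ?e) \<phi>"
    using embedding unfolding elementary_embedding_def by blast
  moreover have "j \<circ> ?e = (\<lambda>_::nat. j x0)(2 := j x1, 3 := j x2, 4 := j x3, 5 := j x4, 6 := j x5)"
    by (simp add: fun_eq_iff)
  ultimately show ?thesis by simp
qed

lemma j_mem: "x \<in> elts M \<Longrightarrow> y \<in> elts M \<Longrightarrow> x \<in> elts y \<longleftrightarrow> j x \<in> elts (j y)"
  using transfer[of x y y y y y "FMem 0 2"] by simp

lemma j_sub: "x \<in> elts M \<Longrightarrow> y \<in> elts M \<Longrightarrow> elts x \<subseteq> elts y \<longleftrightarrow> elts (j x) \<subseteq> elts (j y)"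
  using transfer[of x y y y y y "fSub 0 2"] by (simp add: sat_fSub M_trans N_trans j_in)

lemma j_ordinal: "x \<in> elts M \<Longrightarrow> ordinal x \<longleftrightarrow> ordinal (j x)"
  using transfer[of x x x x x x "fOrd 0"] by (simp add: sat_fOrd M_trans N_trans j_in)

lemma j_succ: "x \<in> elts M \<Longrightarrow> y \<in> elts M \<Longrightarrow> succ_of x y \<longleftrightarrow> succ_of (j x) (j y)"
  using transfer[of x y y y y y "fSucc 0 2"] by (simp add: sat_fSucc M_trans N_trans j_in)

lemma j_empty: "x \<in> elts M \<Longrightarrow> elts x = {} \<longleftrightarrow> elts (j x) = {}"
  using transfer[of x x x x x x "fBall 7 0 (FNot (FEq 7 7))"]
  by (simp add: sat_bounded M_trans N_trans j_in)

text \<open>A least ordinal with \<open>j b \<in> b\<close> would satisfy \<open>j (j b) \<in> j b\<close>.\<close>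

lemma ordinal_le_j:
  assumes "b \<in> elts M" "ordinal b" shows "elts b \<subseteq> elts (j b)"
proof -
  have "b \<in> elts M \<longrightarrow> ordinal b \<longrightarrow> j b \<notin> elts b" for b
  proof (induction b rule: mem_induct)
    case (1 b)
    show ?case
    proof (intro impI notI)
      assume b: "b \<in> elts M" "ordinal b" and jb: "j b \<in> elts b"
      then have "j b \<in> elts M" "ordinal (j b)" using M_in[OF b(1) jb] ordinal_elt[OF b(2) jb] by simp_all
      then show False using 1[OF jb] j_mem[of "j b" b] b jb by blast
    qed
  qed
  then have "j b \<notin> elts b" using assms by blast
  moreover have jb: "ordinal (j b)" using assms j_ordinal by blast
  ultimately have "b \<in> elts (j b) \<or> b = j b" using ordinal_linear[OF assms(2) jb] by blast
  then show ?thesis unfolding ordinal_subset_iff[OF assms(2) jb] .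
qed

lemma crit_properties:
  assumes "nontrivial (elts M) j"
  shows "crit (elts M) j \<in> elts M" "ordinal (crit (elts M) j)"
    "crit (elts M) j \<in> elts (j (crit (elts M) j))"
    "\<And>b. b \<in> elts (crit (elts M) j) \<Longrightarrow> j b = b"
proof -
  let ?S = "moved_ordinals (elts M) j"
  let ?P = "\<lambda>a. a \<in> ?S \<and> (\<forall>b\<in>?S. elts a \<subseteq> elts b)"
  have "?S \<noteq> {}" using assms unfolding nontrivial_def .
  then obtain m where m: "m \<in> ?S" "\<And>b. b \<in> ?S \<Longrightarrow> elts m \<subseteq> elts b"
    by (rule ordinal_least) (auto simp: moved_ordinals_def)
  have c: "crit (elts M) j = m"
    unfolding crit_def by (rule the_equality) (use m in \<open>blast intro: extensionality\<close>)+
  show "crit (elts M) j \<in> elts M" "ordinal (crit (elts M) j)"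
    "crit (elts M) j \<in> elts (j (crit (elts M) j))"
    using m(1) unfolding c moved_ordinals_def by auto
  fix b assume "b \<in> elts (crit (elts M) j)"
  then have b: "b \<in> elts m" "b \<in> elts M" "ordinal b"
    using m(1) M_in[of m b] ordinal_elt[of m b] unfolding c moved_ordinals_def by simp_all
  then have "b \<notin> ?S" using m(2)[of b] mem_irrefl[of b] by blast
  then have "b \<notin> elts (j b)" using b unfolding moved_ordinals_def by blast
  then show "j b = b"
    using ordinal_le_j[OF b(2,3)] ordinal_subset_iff[OF b(3), of "j b"] j_ordinal[OF b(2)] b(3) by simp
qed

text \<open>The critical point exceeds \<open>\<omega>\<close>: it is neither zero nor a successor, and if all its elements
  were, the same would hold of the elements of its image, one of which it is.\<close>

lemma crit_uncountable:
  assumes nt: "nontrivial (elts M) j" and card: "cardinal (j (crit (elts M) j))"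
  shows "uncountable (elts (j (crit (elts M) j)))"
proof -
  let ?c = "crit (elts M) j"
  note c = crit_properties[OF nt]
  have ne: "elts ?c \<noteq> {}" using c j_empty[of ?c] by auto
  have nsucc: "\<not> succ_of b ?c" for b
  proof
    assume s: "succ_of b ?c"
    then have b: "b \<in> elts ?c" unfolding succ_of_def by blast
    then have "succ_of b (j ?c)" using s j_succ[of b ?c] c M_in by auto
    then have "j ?c = ?c" using s unfolding succ_of_def by (intro extensionality) simp
    then show False using c(3) mem_irrefl by metis
  qed
  let ?Q = "\<lambda>x. elts x = {} \<or> (\<exists>y\<in>elts x. succ_of y x)"
  let ?q = "FOr (fBall 9 8 (FNot (FEq 9 9))) (fBex 9 8 (fSucc 9 8))"
  have sat_q: "sat K (e(8 := x)) ?q \<longleftrightarrow> ?Q x" if "trans_class K" "x \<in> K" for K e x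
    using that trans_classD[OF that] by (auto simp: sat_bounded sat_fSucc)
  have sat_B: "sat K e (fBall 8 0 ?q) \<longleftrightarrow> (\<forall>x\<in>elts (e 0). ?Q x)" if K: "trans_class K" "e 0 \<in> K" for K e
  proof -
    have "sat K e (fBall 8 0 ?q) \<longleftrightarrow> (\<forall>x\<in>elts (e 0). sat K (e(8 := x)) ?q)"
      by (rule sat_bounded) (use K in auto)
    also have "\<dots> \<longleftrightarrow> (\<forall>x\<in>elts (e 0). ?Q x)"
      by (rule ball_cong[OF refl]) (rule sat_q[OF K(1) trans_classD[OF K]])
    finally show ?thesis .
  qed
  let ?e = "\<lambda>x. (\<lambda>_::nat. x)(2 := x, 3 := x, 4 := x, 5 := x, 6 := x)"
  have "sat (elts M) (?e ?c) (fBall 8 0 ?q) \<longleftrightarrow> (\<forall>x\<in>elts ?c. ?Q x)"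
    using sat_B[OF M_trans, of "?e ?c"] c(1) by simp
  moreover have "sat N (?e (j ?c)) (fBall 8 0 ?q) \<longleftrightarrow> (\<forall>x\<in>elts (j ?c). ?Q x)"
    using sat_B[OF N_trans, of "?e (j ?c)"] j_in[OF c(1)] by simp
  ultimately have tr: "(\<forall>x\<in>elts ?c. ?Q x) \<longleftrightarrow> (\<forall>x\<in>elts (j ?c). ?Q x)"
    using transfer[of ?c ?c ?c ?c ?c ?c "fBall 8 0 ?q"] c(1) by blast
  have "\<not> ?Q ?c" using ne nsucc by blast
  then obtain x where x: "x \<in> elts ?c" "elts x \<noteq> {}" "\<And>y. \<not> succ_of y x"
    using tr c(3) unfolding succ_of_def by blast
  have ox: "ordinal x" using x(1) c(2) ordinal_elt by blast
  have "vnat k \<in> elts x" for k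
  proof (induction k)
    case 0
    show ?case
      using x(2) ordinal_linear[OF ordinal_vnat[of 0] ox] by auto
  next
    case (Suc k)
    have s: "elts (vnat (Suc k) :: 'v) = insert (vnat k) (elts (vnat k))"
      by (simp add: elts_vset_small small_insert)
    then have "vnat (Suc k) \<noteq> x" using x(3)[of "vnat k"] unfolding succ_of_def by metis
    moreover have "x \<notin> elts (vnat (Suc k))"
      using s Suc mem_irrefl mem_asym by auto
    ultimately show ?case using ordinal_linear[OF ordinal_vnat[of "Suc k"] ox] by blast
  qed
  then have "range (vnat :: nat \<Rightarrow> 'v) \<subseteq> elts x" by blast
  then have "(UNIV :: nat set) \<lesssim> elts x" using inj_vnat unfolding lepoll_def by blast
  moreover have "x \<in> elts (j ?c)"
    using x(1) c(3) ordinal_transD[OF cardinal_ordinal[OF card]] by blast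
  then have "elts x \<prec> elts (j ?c)" using card unfolding cardinal_def by blast
  ultimately have less: "(UNIV :: nat set) \<prec> elts (j ?c)" by (rule lesspoll_trans1)
  show ?thesis
  proof
    assume "countable (elts (j ?c))"
    then have "elts (j ?c) \<lesssim> (UNIV :: nat set)" unfolding countable_def lepoll_def by auto
    then show False using less lesspoll_trans2 lesspoll_not_refl by blast
  qed
qed

end

text \<open>The class \<open>H \<theta>\<close> is closed under power sets so that it is correct about cardinals and about ultrafilters
  on power sets.\<close>

locale measure_embedding = elementary_pair M "H \<theta>" j
  for M :: "'v::zfc" and \<theta> :: 'v and j :: "'v \<Rightarrow> 'v" +
  fixes n :: nat
  assumes closed: "\<And>x. x \<in> H \<theta> \<Longrightarrow> vpow x \<in> H \<theta>"
    and nt: "nontrivial (elts M) j"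
    and cardinal_j_crit: "cardinal (j (crit (elts M) j))"
    and iterates: "\<And>i. i \<le> n \<Longrightarrow> (j ^^ i) (crit (elts M) j) \<in> elts M"
    and measure: "vset {A \<in> elts (vpow_in M (vpow_in M ((j ^^ n) (crit (elts M) j)))).
                vset (j ` elts ((j ^^ n) (crit (elts M) j))) \<in> elts (j A)} \<in> elts M"
begin

text \<open>The sequence \<open>c\<close> of iterated images of the critical point has \<open>c i \<in> M\<close> for \<open>i \<le> n\<close>; its member
  \<open>c (n + 1) = lam\<close> lies in \<open>H \<theta>\<close> only. The cardinals that witness hugeness are \<open>c 1, \<dots>, c (n + 1)\<close>. The set
  \<open>W\<close> is the measure on the subsets of \<open>l = c n\<close> in \<open>M\<close> that the seed \<open>s = j[l]\<close> generates; its image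
  under \<open>j\<close> is the ultrafilter on the power set \<open>S\<close> of \<open>lam\<close>.\<close>

definition c :: "nat \<Rightarrow> 'v" where "c i = (j ^^ i) (crit (elts M) j)"
definition l :: 'v where "l = c n"
definition s :: 'v where "s = vset (j ` elts l)"
definition W :: 'v where "W = vset {A \<in> elts (vpow_in M (vpow_in M l)). s \<in> elts (j A)}"
definition lam :: 'v where "lam = j l"
definition S :: 'v where "S = vpow lam"

lemma c_Suc: "c (Suc i) = j (c i)"
  unfolding c_def by simp

lemma c_M: "i \<le> n \<Longrightarrow> c i \<in> elts M"
  unfolding c_def by (rule iterates)

lemma c_H: "i \<le> n \<Longrightarrow> c (Suc i) \<in> H \<theta>"
  unfolding c_Suc by (rule j_in[OF c_M])

lemma l_M: "l \<in> elts M" and W_M: "W \<in> elts M" and lam_H: "lam \<in> H \<theta>" and S_H: "S \<in> H \<theta>"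
proof -
  show "l \<in> elts M" "W \<in> elts M"
    using c_M measure unfolding l_def W_def s_def c_def by auto
  then show "lam \<in> H \<theta>" "S \<in> H \<theta>" unfolding S_def lam_def using j_in closed by auto
qed

lemma lam_c: "lam = c (Suc n)"
  unfolding lam_def l_def c_Suc ..

lemma c_ordinal: "i \<le> Suc n \<Longrightarrow> ordinal (c i)"
proof (induction i)
  case 0
  show ?case using crit_properties(2)[OF nt] unfolding c_def by simp
next
  case (Suc i)
  then show ?case using j_ordinal[OF c_M[of i]] unfolding c_Suc by simp
qed

lemma c_inc: "i \<le> n \<Longrightarrow> c i \<in> elts (c (Suc i))"
proof (induction i)
  case 0
  show ?case using crit_properties(3)[OF nt] unfolding c_def by simp
next
  case (Suc i)
  then show ?case using j_mem[OF c_M[of i] c_M[of "Suc i"]] unfolding c_Suc by simp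
qed

lemma c_mono: "i \<le> k \<Longrightarrow> k \<le> Suc n \<Longrightarrow> elts (c i) \<subseteq> elts (c k)"
proof (induction k)
  case (Suc k)
  show ?case
  proof (cases "i = Suc k")
    case False
    then have "elts (c i) \<subseteq> elts (c k)" using Suc by simp
    also have "\<dots> \<subseteq> elts (c (Suc k))" using ordinal_subset[OF c_ordinal c_inc] Suc.prems by simp
    finally show ?thesis .
  qed simp
qed simp

text \<open>A cardinal in \<open>M\<close> is a cardinal in the sense of \<open>M\<close>, so its image is one in the sense of \<open>H \<theta>\<close>, which is
  correct about this.\<close>

lemma c_cardinal: "i \<le> n \<Longrightarrow> cardinal (c (Suc i))"
proof (induction i)
  case 0
  show ?case using cardinal_j_crit unfolding c_def by simp
next
  case (Suc i)
  let ?k = "c (Suc i)"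
  have k: "?k \<in> elts M" "cardinal ?k" using Suc c_M by auto
  let ?e = "\<lambda>x. (\<lambda>_::nat. x)(2 := x, 3 := x, 4 := x, 5 := x, 6 := x)"
  have "sat (elts M) (?e ?k) (fCard 0)"
    using k(1) cardinal_no_onto[OF k(2)] cardinal_ordinal[OF k(2)] by (simp add: sat_fCard M_trans)
  then have "sat (H \<theta>) (?e (j ?k)) (fCard 0)"
    using transfer[of ?k ?k ?k ?k ?k ?k "fCard 0"] k(1) by blast
  then show ?case
    using j_in[OF k(1)] cardinal_if_no_onto[OF closed, of "j ?k"] unfolding c_Suc[of "Suc i"]
    by (simp add: sat_fCard N_trans)
qed

lemma j_below_crit: "b \<in> elts (c 0) \<Longrightarrow> j b = b"
  using crit_properties(4)[OF nt] unfolding c_def by simp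

lemma elts_s: "elts s = j ` elts l"
  unfolding s_def by (rule elts_vset_image)

lemma s_subset: "elts s \<subseteq> elts lam"
  unfolding elts_s lam_def using j_mem l_M M_in by blast

lemma s_H: "s \<in> H \<theta>" and s_S: "s \<in> elts S"
  using s_subset H_subset[OF lam_H] unfolding S_def elts_vpow by auto

lemma subset_S: "elts lam \<subseteq> elts S"
  unfolding S_def lam_c using subset_vpow ordinal_transitive c_ordinal by blast

definition Sbar :: 'v where "Sbar = vpow_in M l"

lemma elts_Sbar: "elts Sbar = {y \<in> elts M. elts y \<subseteq> elts l}"
  unfolding Sbar_def by (rule elts_vpow_in)

text \<open>The existence of power sets transfers from \<open>H \<theta>\<close> down to \<open>M\<close>, although \<open>M\<close> is not assumed to be
  closed under any operation.\<close>

lemma Sbar_M: "Sbar \<in> elts M" and j_Sbar: "j Sbar = S"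
proof -
  let ?is_pow = "FAll 7 (FIff (FMem 7 2) (fSub 7 0))"
  let ?e = "\<lambda>x y. (\<lambda>_::nat. x)(2 := y, 3 := y, 4 := y, 5 := y, 6 := y)"
  have sat: "sat K (?e x y) ?is_pow \<longleftrightarrow> (\<forall>z\<in>K. z \<in> elts y \<longleftrightarrow> elts z \<subseteq> elts x)" if "trans_class K" for K x y
    using that by (simp add: sat_fSub)
  have sat_ex: "sat K (?e x x) (FEx 2 ?is_pow) \<longleftrightarrow> (\<exists>y\<in>K. \<forall>z\<in>K. z \<in> elts y \<longleftrightarrow> elts z \<subseteq> elts x)"
    if "trans_class K" for K x
    using that by (simp add: sat_fSub)
  have "sat (H \<theta>) (?e (j l) (j l)) (FEx 2 ?is_pow)"
    unfolding sat_ex[OF N_trans] using S_H unfolding S_def lam_def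
    by (intro bexI[of _ "vpow (j l)"]) (auto simp: elts_vpow)
  then have "sat (elts M) (?e l l) (FEx 2 ?is_pow)"
    using transfer[of l l l l l l "FEx 2 ?is_pow"] l_M by blast
  then obtain y where y: "y \<in> elts M" "\<And>z. z \<in> elts M \<Longrightarrow> z \<in> elts y \<longleftrightarrow> elts z \<subseteq> elts l"
    unfolding sat_ex[OF M_trans] by blast
  then have "elts y = elts Sbar" unfolding elts_Sbar using M_in by blast
  then have y_eq: "y = Sbar" by (rule extensionality)
  then show "Sbar \<in> elts M" using y by simp
  have "sat (elts M) (?e l Sbar) ?is_pow" using y(2) unfolding sat[OF M_trans] y_eq by blast
  then have "sat (H \<theta>) (?e (j l) (j Sbar)) ?is_pow"
    using transfer[of l Sbar Sbar Sbar Sbar Sbar ?is_pow] l_M \<open>Sbar \<in> elts M\<close> by blast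
  then have *: "z \<in> elts (j Sbar) \<longleftrightarrow> elts z \<subseteq> elts lam" if "z \<in> H \<theta>" for z
    unfolding sat[OF N_trans] lam_def using that by blast
  have "elts (j Sbar) = elts S"
    unfolding S_def elts_vpow
    using * H_subset[OF lam_H] H_transitive[OF j_in[OF \<open>Sbar \<in> elts M\<close>]] by blast
  then show "j Sbar = S" by (rule extensionality)
qed

lemma elts_W: "elts W = {A \<in> elts M. elts A \<subseteq> elts Sbar \<and> s \<in> elts (j A)}"
proof -
  have "{A \<in> elts (vpow_in M (vpow_in M l)). s \<in> elts (j A)} \<subseteq> elts M"
    by (auto simp: elts_vpow_in)
  then have "elts W = {A \<in> elts (vpow_in M (vpow_in M l)). s \<in> elts (j A)}"
    unfolding W_def by (rule elts_vset_subset)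
  then show ?thesis by (auto simp: elts_vpow_in[of M "vpow_in _ _"] Sbar_def)
qed

definition V :: 'v where "V = j W"

lemma V_H: "V \<in> H \<theta>" unfolding V_def by (rule j_in[OF W_M])

text \<open>A formula with the meaning \<open>\<Phi>\<close> carries \<open>\<Phi>\<close> from \<open>M\<close>, about \<open>W\<close>, to \<open>H \<theta>\<close>, about \<open>V = j W\<close>.\<close>

lemma reflect:
  assumes sat: "\<And>K e. trans_class K \<Longrightarrow> (\<And>i. e i \<in> K) \<Longrightarrow>
      sat K e \<phi> \<longleftrightarrow> \<Phi> K (e 0) (e 2) (e 3) (e 4) (e 5) (e 6)"
    and M: "\<Phi> (elts M) W Sbar l (c 0) a b" "a \<in> elts M" "b \<in> elts M"
  shows "\<Phi> (H \<theta>) V S lam (c (Suc 0)) (j a) (j b)"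
proof -
  let ?e = "(\<lambda>_::nat. W)(2 := Sbar, 3 := l, 4 := c 0, 5 := a, 6 := b)"
  let ?e' = "(\<lambda>_::nat. V)(2 := S, 3 := lam, 4 := c (Suc 0), 5 := j a, 6 := j b)"
  have "sat (elts M) ?e \<phi>"
    using M by (subst sat) (auto simp: M_trans W_M Sbar_M l_M c_M)
  then have "sat (H \<theta>) ?e' \<phi>"
    using transfer[of W Sbar l "c 0" a b \<phi>] M W_M Sbar_M l_M c_M[of 0]
    unfolding V_def j_Sbar lam_def c_Suc by blast
  then show ?thesis
    using M by (subst (asm) sat) (auto simp: N_trans V_H S_H lam_H c_H j_in)
qed

text \<open>A subset of \<open>Sbar\<close> defined in \<open>M\<close> by a formula is mapped to the subset of \<open>S\<close> defined in \<open>H \<theta>\<close>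
  by that formula, so it belongs to \<open>W\<close> iff \<open>s\<close> satisfies the formula.\<close>

lemma mem_W_iff:
  assumes par: "X \<in> elts M" "u \<in> elts M" "v \<in> elts M" "w \<in> elts M" "f \<in> elts M"
    and sat: "\<And>K e. trans_class K \<Longrightarrow> e 0 \<in> K \<Longrightarrow> e 2 \<in> K \<Longrightarrow> e 3 \<in> K \<Longrightarrow> e 4 \<in> K \<Longrightarrow> e 7 \<in> K \<Longrightarrow>
      sat K e \<phi> \<longleftrightarrow> \<Phi> K (e 0) (e 2) (e 3) (e 4) (e 7)"
    and X: "\<And>a. a \<in> elts M \<Longrightarrow> a \<in> elts X \<longleftrightarrow> a \<in> elts Sbar \<and> \<Phi> (elts M) u v w f a"
  shows "X \<in> elts W \<longleftrightarrow> \<Phi> (H \<theta>) (j u) (j v) (j w) (j f) s"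
proof -
  let ?\<psi> = "FAll 7 (FIff (FMem 7 5) (FAnd (FMem 7 6) \<phi>))"
  let ?e = "\<lambda>u v w f X S. (\<lambda>_::nat. u)(2 := v, 3 := w, 4 := f, 5 := X, 6 := S)"
  have *: "sat K (?e u v w f X S) ?\<psi> \<longleftrightarrow> (\<forall>a\<in>K. a \<in> elts X \<longleftrightarrow> a \<in> elts S \<and> \<Phi> K u v w f a)"
    if "trans_class K" "u \<in> K" "v \<in> K" "w \<in> K" "f \<in> K" for K u v w f X S
    using that by (simp add: sat)
  have "sat (elts M) (?e u v w f X Sbar) ?\<psi>" using X * M_trans par by blast
  then have "sat (H \<theta>) (?e (j u) (j v) (j w) (j f) (j X) (j Sbar)) ?\<psi>"
    using transfer[of u v w f X Sbar ?\<psi>] par Sbar_M by blast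
  then have "\<forall>a\<in>H \<theta>. a \<in> elts (j X) \<longleftrightarrow> a \<in> elts S \<and> \<Phi> (H \<theta>) (j u) (j v) (j w) (j f) a"
    using * N_trans par j_in unfolding j_Sbar by blast
  then have "s \<in> elts (j X) \<longleftrightarrow> \<Phi> (H \<theta>) (j u) (j v) (j w) (j f) s" using s_H s_S by blast
  moreover have "elts X \<subseteq> elts Sbar" using X M_in[OF par(1)] by blast
  ultimately show ?thesis unfolding elts_W using par(1) by blast
qed

subsection \<open>The ultrafilter\<close>

text \<open>Closure of \<open>V\<close> under an operation is phrased as membership of every set that is the result of the
  operation. In \<open>M\<close>, which need not contain the results, this holds of \<open>W\<close> because membership in \<open>W\<close> is
  truth at the seed \<open>s\<close>. Then it reflects to \<open>V\<close>, and closure of \<open>H \<theta>\<close> under subsets supplies the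
  results.\<close>

lemma V_subset: assumes "X \<in> elts V" shows "elts X \<subseteq> elts S"
proof -
  let ?\<phi> = "FAll 7 (FImp (FMem 7 0) (fSub 7 2))"
  let ?\<Phi> = "\<lambda>K V S lam k d e. \<forall>X\<in>K. X \<in> elts V \<longrightarrow> elts X \<subseteq> elts S"
  have M_holds: "?\<Phi> (elts M) W Sbar l (c 0) W W"
    unfolding elts_W by blast
  have "\<forall>X\<in>H \<theta>. X \<in> elts V \<longrightarrow> elts X \<subseteq> elts S"
    by (rule reflect[where \<Phi> = ?\<Phi> and \<phi> = ?\<phi>, OF _ M_holds W_M W_M]) (simp add: sat_fSub)
  then show ?thesis using assms H_transitive[OF V_H] by blast
qed

lemma S_mem_V: "S \<in> elts V"
proof -
  have "Sbar \<in> elts W" unfolding elts_W using Sbar_M j_Sbar s_S by simp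
  then show ?thesis using j_mem[OF Sbar_M W_M] unfolding V_def j_Sbar by blast
qed

lemma V_nonempty: assumes "X \<in> elts V" shows "elts X \<noteq> {}"
proof -
  let ?\<phi> = "FAll 7 (FImp (FMem 7 0) (FNot (fBall 8 7 (FNot (FEq 8 8)))))"
  let ?\<Phi> = "\<lambda>K V S lam k d e. \<forall>X\<in>K. X \<in> elts V \<longrightarrow> elts X \<noteq> {}"
  have M_holds: "?\<Phi> (elts M) W Sbar l (c 0) W W"
    using j_empty unfolding elts_W by blast
  have "\<forall>X\<in>H \<theta>. X \<in> elts V \<longrightarrow> elts X \<noteq> {}"
    by (rule reflect[where \<Phi> = ?\<Phi> and \<phi> = ?\<phi>, OF _ M_holds W_M W_M]) (simp add: sat_bounded)
  then show ?thesis using assms H_transitive[OF V_H] by blast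
qed

lemma V_upward: "X \<in> elts V \<Longrightarrow> elts X \<subseteq> elts Y \<Longrightarrow> elts Y \<subseteq> elts S \<Longrightarrow> Y \<in> elts V"
proof -
  let ?\<phi> = "FAll 7 (FImp (FMem 7 0) (FAll 8 (FImp (FAnd (fSub 7 8) (fSub 8 2)) (FMem 8 0))))"
  have mem_W: "Y \<in> elts W" if "X \<in> elts W" "Y \<in> elts M" "elts X \<subseteq> elts Y" "elts Y \<subseteq> elts Sbar" for X Y
    using that j_sub[of X Y] unfolding elts_W by blast
  let ?\<Phi> = "\<lambda>K V S lam k d e. \<forall>X\<in>K. X \<in> elts V \<longrightarrow>
      (\<forall>Y\<in>K. elts X \<subseteq> elts Y \<and> elts Y \<subseteq> elts S \<longrightarrow> Y \<in> elts V)"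
  have M_holds: "?\<Phi> (elts M) W Sbar l (c 0) W W"
    using mem_W by blast
  have "\<forall>X\<in>H \<theta>. X \<in> elts V \<longrightarrow>
      (\<forall>Y\<in>H \<theta>. elts X \<subseteq> elts Y \<and> elts Y \<subseteq> elts S \<longrightarrow> Y \<in> elts V)"
    by (rule reflect[where \<Phi> = ?\<Phi> and \<phi> = ?\<phi>, OF _ M_holds W_M W_M]) (simp add: sat_fSub)
  then show "X \<in> elts V \<Longrightarrow> elts X \<subseteq> elts Y \<Longrightarrow> elts Y \<subseteq> elts S \<Longrightarrow> Y \<in> elts V"
    using H_transitive[OF V_H] H_subset[OF S_H] by blast
qed

lemma V_Int:
  assumes "X \<in> elts V" "Y \<in> elts V" "elts Z = elts X \<inter> elts Y" shows "Z \<in> elts V"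
proof -
  let ?\<phi> = "FAll 7 (FAll 8 (FAll 9 (FImp (FAnd (FMem 7 0) (FAnd (FMem 8 0)
    (FAll 10 (FIff (FMem 10 9) (FAnd (FMem 10 7) (FMem 10 8)))))) (FMem 9 0))))"
  have mem_W: "Z \<in> elts W" if "Z \<in> elts M" "X \<in> elts W" "Y \<in> elts W"
    and Z: "\<forall>a\<in>elts M. a \<in> elts Z \<longleftrightarrow> a \<in> elts X \<and> a \<in> elts Y" for X Y Z
  proof -
    have XY: "X \<in> elts M" "Y \<in> elts M" "elts X \<subseteq> elts Sbar" "s \<in> elts (j X)" "s \<in> elts (j Y)"
      using that unfolding elts_W by auto
    have "Z \<in> elts W \<longleftrightarrow> s \<in> elts (j X) \<and> s \<in> elts (j Y)"
      by (rule mem_W_iff[where u = X and v = Y and w = X and f = X and \<phi> = "FAnd (FMem 7 0) (FMem 7 2)"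
            and \<Phi> = "\<lambda>K u v w f a. a \<in> elts u \<and> a \<in> elts v"])
        (use XY Z that(1) in auto)
    then show ?thesis using XY by blast
  qed
  let ?\<Phi> = "\<lambda>K V S lam k d e. \<forall>X\<in>K. \<forall>Y\<in>K. \<forall>Z\<in>K. X \<in> elts V \<and> Y \<in> elts V \<and>
      (\<forall>a\<in>K. a \<in> elts Z \<longleftrightarrow> a \<in> elts X \<and> a \<in> elts Y) \<longrightarrow> Z \<in> elts V"
  have M_holds: "?\<Phi> (elts M) W Sbar l (c 0) W W"
    using mem_W by blast
  have "\<forall>X\<in>H \<theta>. \<forall>Y\<in>H \<theta>. \<forall>Z\<in>H \<theta>. X \<in> elts V \<and> Y \<in> elts V \<and>
      (\<forall>a\<in>H \<theta>. a \<in> elts Z \<longleftrightarrow> a \<in> elts X \<and> a \<in> elts Y) \<longrightarrow> Z \<in> elts V"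
    by (rule reflect[where \<Phi> = ?\<Phi> and \<phi> = ?\<phi>, OF _ M_holds W_M W_M]) simp
  moreover have "X \<in> H \<theta>" "Y \<in> H \<theta>" using assms H_transitive[OF V_H] by auto
  moreover have "Z \<in> H \<theta>" using H_subset[OF \<open>X \<in> H \<theta>\<close>] assms(3) by blast
  ultimately show ?thesis using assms by blast
qed

lemma V_ultra:
  assumes "elts X \<subseteq> elts S" "elts Y = elts S - elts X" shows "X \<in> elts V \<or> Y \<in> elts V"
proof -
  let ?\<phi> = "FAll 7 (FAll 8 (FImp (FAnd (fSub 7 2)
    (FAll 10 (FIff (FMem 10 8) (FAnd (FMem 10 2) (FNot (FMem 10 7)))))) (FOr (FMem 7 0) (FMem 8 0))))"
  have mem_W: "X \<in> elts W \<or> Y \<in> elts W" if "X \<in> elts M" "Y \<in> elts M" "elts X \<subseteq> elts Sbar"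
    and Y: "\<forall>a\<in>elts M. a \<in> elts Y \<longleftrightarrow> a \<in> elts Sbar \<and> a \<notin> elts X" for X Y
  proof -
    have "Y \<in> elts W \<longleftrightarrow> s \<notin> elts (j X)"
      by (rule mem_W_iff[where u = X and v = X and w = X and f = X and \<phi> = "FNot (FMem 7 0)"
            and \<Phi> = "\<lambda>K u v w f a. a \<notin> elts u"])
        (use Y that in auto)
    then show ?thesis using that unfolding elts_W by blast
  qed
  let ?\<Phi> = "\<lambda>K V S lam k d e. \<forall>X\<in>K. \<forall>Y\<in>K. elts X \<subseteq> elts S \<and>
      (\<forall>a\<in>K. a \<in> elts Y \<longleftrightarrow> a \<in> elts S \<and> a \<notin> elts X) \<longrightarrow> X \<in> elts V \<or> Y \<in> elts V"
  have M_holds: "?\<Phi> (elts M) W Sbar l (c 0) W W"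
    using mem_W by blast
  have "\<forall>X\<in>H \<theta>. \<forall>Y\<in>H \<theta>. elts X \<subseteq> elts S \<and>
      (\<forall>a\<in>H \<theta>. a \<in> elts Y \<longleftrightarrow> a \<in> elts S \<and> a \<notin> elts X) \<longrightarrow> X \<in> elts V \<or> Y \<in> elts V"
    by (rule reflect[where \<Phi> = ?\<Phi> and \<phi> = ?\<phi>, OF _ M_holds W_M W_M]) (simp add: sat_fSub)
  moreover have "X \<in> H \<theta>" "Y \<in> H \<theta>" using assms H_subset[OF S_H] by auto
  ultimately show ?thesis using assms by blast
qed

lemma V_fine:
  assumes "\<alpha> \<in> elts lam" "elts X = {a \<in> elts S. \<alpha> \<in> elts a}" shows "X \<in> elts V"
proof -
  let ?\<phi> = "FAll 7 (FImp (FMem 7 3) (FAll 8 (FImp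
    (FAll 10 (FIff (FMem 10 8) (FAnd (FMem 10 2) (FMem 7 10)))) (FMem 8 0))))"
  have mem_W: "X \<in> elts W" if "\<alpha> \<in> elts l" "X \<in> elts M"
    and X: "\<forall>a\<in>elts M. a \<in> elts X \<longleftrightarrow> a \<in> elts Sbar \<and> \<alpha> \<in> elts a" for \<alpha> X
  proof -
    have "\<alpha> \<in> elts M" using that M_in l_M by blast
    have "X \<in> elts W \<longleftrightarrow> j \<alpha> \<in> elts s"
      by (rule mem_W_iff[where u = \<alpha> and v = \<alpha> and w = \<alpha> and f = \<alpha> and \<phi> = "FMem 0 7"
            and \<Phi> = "\<lambda>K u v w f a. u \<in> elts a"])
        (use X that \<open>\<alpha> \<in> elts M\<close> in auto)
    then show ?thesis using that unfolding elts_s by blast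
  qed
  let ?\<Phi> = "\<lambda>K V S lam k d e. \<forall>\<alpha>\<in>K. \<alpha> \<in> elts lam \<longrightarrow> (\<forall>X\<in>K.
      (\<forall>a\<in>K. a \<in> elts X \<longleftrightarrow> a \<in> elts S \<and> \<alpha> \<in> elts a) \<longrightarrow> X \<in> elts V)"
  have M_holds: "?\<Phi> (elts M) W Sbar l (c 0) W W"
    using mem_W by blast
  have "\<forall>\<alpha>\<in>H \<theta>. \<alpha> \<in> elts lam \<longrightarrow> (\<forall>X\<in>H \<theta>.
      (\<forall>a\<in>H \<theta>. a \<in> elts X \<longleftrightarrow> a \<in> elts S \<and> \<alpha> \<in> elts a) \<longrightarrow> X \<in> elts V)"
    by (rule reflect[where \<Phi> = ?\<Phi> and \<phi> = ?\<phi>, OF _ M_holds W_M W_M]) simp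
  moreover have "\<alpha> \<in> H \<theta>" using assms(1) H_transitive[OF lam_H] by blast
  moreover have "X \<in> H \<theta>" using assms(2) H_subset[OF S_H] by blast
  ultimately show ?thesis using assms by blast
qed

text \<open>Normality and \<open>\<kappa>\<close>-completeness at once, for relations instead of functions. In both cases the
  image of the relation relates \<open>s\<close> to some \<open>j \<alpha>\<close> with \<open>\<alpha> \<in> l\<close>, because all elements of \<open>s\<close> and of
  \<open>j \<beta> = \<beta>\<close> have this form.\<close>

lemma W_normal:
  assumes M: "f \<in> elts M" "\<beta> \<in> elts M" and X: "X \<in> elts W"
    and cases: "\<beta> \<in> elts (c 0) \<and> (\<forall>a\<in>elts M. a \<in> elts X \<longrightarrow> (\<exists>y\<in>elts M. y \<in> elts \<beta> \<and> rel f a y)) \<or>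
      (\<forall>a\<in>elts M. a \<in> elts X \<longrightarrow> (\<exists>y\<in>elts M. y \<in> elts a \<and> rel f a y))"
  shows "\<exists>\<alpha>\<in>elts M. \<alpha> \<in> elts l \<and> (\<forall>Y\<in>elts M.
    (\<forall>a\<in>elts M. a \<in> elts Y \<longleftrightarrow> a \<in> elts Sbar \<and> rel f a \<alpha>) \<longrightarrow> Y \<in> elts W)"
proof -
  have XM: "X \<in> elts M" and sX: "s \<in> elts (j X)" using X unfolding elts_W by auto
  have "\<exists>\<alpha>\<in>elts l. rel (j f) s (j \<alpha>)"
    using cases
  proof (elim disjE conjE)
    assume \<beta>: "\<beta> \<in> elts (c 0)"
      and *: "\<forall>a\<in>elts M. a \<in> elts X \<longrightarrow> (\<exists>y\<in>elts M. y \<in> elts \<beta> \<and> rel f a y)"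
    have "\<forall>a\<in>H \<theta>. a \<in> elts (j X) \<longrightarrow> (\<exists>y\<in>H \<theta>. y \<in> elts (j \<beta>) \<and> rel (j f) a y)"
      using transfer[of X \<beta> f f f f "FAll 7 (FImp (FMem 7 0) (FEx 8 (FAnd (FMem 8 2) (fRel 3 7 8))))"]
        M XM * by (simp add: sat_fRel M_trans N_trans j_in)
    then obtain y where y: "y \<in> elts \<beta>" "rel (j f) s y" using s_H sX j_below_crit[OF \<beta>] by auto
    then have "y \<in> elts (c 0)" using \<beta> ordinal_transD[OF c_ordinal[of 0]] by blast
    moreover from this have "y \<in> elts l" using c_mono[of 0 n] unfolding l_def by auto
    ultimately show ?thesis using y(2) j_below_crit[of y] by (intro bexI[of _ y]) simp_all
  next
    assume *: "\<forall>a\<in>elts M. a \<in> elts X \<longrightarrow> (\<exists>y\<in>elts M. y \<in> elts a \<and> rel f a y)"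
    have "\<forall>a\<in>H \<theta>. a \<in> elts (j X) \<longrightarrow> (\<exists>y\<in>H \<theta>. y \<in> elts a \<and> rel (j f) a y)"
      using transfer[of X f f f f f "FAll 7 (FImp (FMem 7 0) (FEx 8 (FAnd (FMem 8 7) (fRel 3 7 8))))"]
        M XM * by (simp add: sat_fRel M_trans N_trans j_in)
    then obtain y where "y \<in> elts s" "rel (j f) s y" using s_H sX by blast
    then show ?thesis unfolding elts_s by blast
  qed
  then obtain \<alpha> where \<alpha>: "\<alpha> \<in> elts l" "rel (j f) s (j \<alpha>)" by blast
  then have \<alpha>M: "\<alpha> \<in> elts M" using M_in[OF l_M] by blast
  have "Y \<in> elts W" if Y: "Y \<in> elts M" "\<forall>a\<in>elts M. a \<in> elts Y \<longleftrightarrow> a \<in> elts Sbar \<and> rel f a \<alpha>" for Y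
  proof -
    have "Y \<in> elts W \<longleftrightarrow> rel (j f) s (j \<alpha>)"
      by (rule mem_W_iff[where u = \<alpha> and v = \<alpha> and w = \<alpha> and f = f and \<phi> = "fRel 4 7 0"
            and \<Phi> = "\<lambda>K u v w f a. rel f a u"])
        (use Y \<alpha>M M in \<open>auto simp: sat_fRel\<close>)
    then show ?thesis using \<alpha>(2) by blast
  qed
  then show ?thesis using \<alpha>(1) \<alpha>M by blast
qed

lemma V_normal:
  assumes f: "f \<in> H \<theta>" and X: "X \<in> elts V"
    and cases: "(\<exists>\<beta>\<in>elts (c (Suc 0)). \<forall>a\<in>elts X. \<exists>y\<in>elts \<beta>. rel f a y) \<or>
      (\<forall>a\<in>elts X. \<exists>y\<in>elts a. rel f a y)"
  shows "\<exists>\<alpha>\<in>elts lam. vset {a \<in> elts S. rel f a \<alpha>} \<in> elts V"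
proof -
  let ?\<phi> = "FAll 7 (FAll 8 (FAll 9 (FImp (FAnd (FMem 8 0)
     (FOr (FAnd (FMem 9 4) (FAll 10 (FImp (FMem 10 8) (FEx 11 (FAnd (FMem 11 9) (fRel 7 10 11))))))
        (FAll 10 (FImp (FMem 10 8) (FEx 11 (FAnd (FMem 11 10) (fRel 7 10 11)))))))
     (FEx 12 (FAnd (FMem 12 3) (FAll 13 (FImp
        (FAll 10 (FIff (FMem 10 13) (FAnd (FMem 10 2) (fRel 7 10 12)))) (FMem 13 0))))))))"
  let ?\<Phi> = "\<lambda>K V S lam k d e. \<forall>f\<in>K. \<forall>X\<in>K. \<forall>\<beta>\<in>K. X \<in> elts V \<and>
      (\<beta> \<in> elts k \<and> (\<forall>a\<in>K. a \<in> elts X \<longrightarrow> (\<exists>y\<in>K. y \<in> elts \<beta> \<and> rel f a y)) \<or>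
      (\<forall>a\<in>K. a \<in> elts X \<longrightarrow> (\<exists>y\<in>K. y \<in> elts a \<and> rel f a y))) \<longrightarrow>
      (\<exists>\<alpha>\<in>K. \<alpha> \<in> elts lam \<and> (\<forall>Y\<in>K.
         (\<forall>a\<in>K. a \<in> elts Y \<longleftrightarrow> a \<in> elts S \<and> rel f a \<alpha>) \<longrightarrow> Y \<in> elts V))"
  have M_holds: "?\<Phi> (elts M) W Sbar l (c 0) W W"
    using W_normal by blast
  have *: "\<forall>f\<in>H \<theta>. \<forall>X\<in>H \<theta>. \<forall>\<beta>\<in>H \<theta>. X \<in> elts V \<and>
      (\<beta> \<in> elts (c (Suc 0)) \<and> (\<forall>a\<in>H \<theta>. a \<in> elts X \<longrightarrow> (\<exists>y\<in>H \<theta>. y \<in> elts \<beta> \<and> rel f a y)) \<or>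
      (\<forall>a\<in>H \<theta>. a \<in> elts X \<longrightarrow> (\<exists>y\<in>H \<theta>. y \<in> elts a \<and> rel f a y))) \<longrightarrow>
      (\<exists>\<alpha>\<in>H \<theta>. \<alpha> \<in> elts lam \<and> (\<forall>Y\<in>H \<theta>.
         (\<forall>a\<in>H \<theta>. a \<in> elts Y \<longleftrightarrow> a \<in> elts S \<and> rel f a \<alpha>) \<longrightarrow> Y \<in> elts V))"
    by (rule reflect[where \<Phi> = ?\<Phi> and \<phi> = ?\<phi>, OF _ M_holds W_M W_M]) (simp add: sat_fRel)
  have XH: "X \<in> H \<theta>" using X H_transitive[OF V_H] by blast
  have kH: "c (Suc 0) \<in> H \<theta>" by (rule c_H) simp
  have "\<exists>\<beta>\<in>H \<theta>. \<beta> \<in> elts (c (Suc 0)) \<and> (\<forall>a\<in>H \<theta>. a \<in> elts X \<longrightarrow> (\<exists>y\<in>H \<theta>. y \<in> elts \<beta> \<and> rel f a y)) \<or>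
      (\<forall>a\<in>H \<theta>. a \<in> elts X \<longrightarrow> (\<exists>y\<in>H \<theta>. y \<in> elts a \<and> rel f a y))"
    using cases
  proof
    assume "\<exists>\<beta>\<in>elts (c (Suc 0)). \<forall>a\<in>elts X. \<exists>y\<in>elts \<beta>. rel f a y"
    then obtain \<beta> where "\<beta> \<in> elts (c (Suc 0))" "\<forall>a\<in>elts X. \<exists>y\<in>elts \<beta>. rel f a y" by blast
    then show ?thesis
      using H_transitive[OF kH] H_transitive by (intro bexI[of _ \<beta>] disjI1 conjI) blast+
  next
    assume "\<forall>a\<in>elts X. \<exists>y\<in>elts a. rel f a y"
    then show ?thesis
      using kH H_transitive by (intro bexI[of _ "c (Suc 0)"] disjI2) blast+
  qed
  then obtain \<beta> where \<beta>: "\<beta> \<in> H \<theta>" "\<beta> \<in> elts (c (Suc 0)) \<and> (\<forall>a\<in>H \<theta>. a \<in> elts X \<longrightarrow> (\<exists>y\<in>H \<theta>. y \<in> elts \<beta> \<and> rel f a y)) \<or>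
      (\<forall>a\<in>H \<theta>. a \<in> elts X \<longrightarrow> (\<exists>y\<in>H \<theta>. y \<in> elts a \<and> rel f a y))"
    by (elim bexE)
  have "\<exists>\<alpha>\<in>H \<theta>. \<alpha> \<in> elts lam \<and> (\<forall>Y\<in>H \<theta>.
         (\<forall>a\<in>H \<theta>. a \<in> elts Y \<longleftrightarrow> a \<in> elts S \<and> rel f a \<alpha>) \<longrightarrow> Y \<in> elts V)"
    by (rule mp[OF bspec[OF bspec[OF bspec[OF * f] XH] \<beta>(1)]]) (intro conjI X \<beta>(2))
  then obtain \<alpha> where \<alpha>: "\<alpha> \<in> elts lam" and Y: "\<And>Y. Y \<in> H \<theta> \<Longrightarrow>
      (\<forall>a\<in>H \<theta>. a \<in> elts Y \<longleftrightarrow> a \<in> elts S \<and> rel f a \<alpha>) \<Longrightarrow> Y \<in> elts V"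
    by blast
  have Y_elts: "elts (vset {a \<in> elts S. rel f a \<alpha>}) = {a \<in> elts S. rel f a \<alpha>}"
    by (rule elts_vset_subset[of _ S]) blast
  then have "vset {a \<in> elts S. rel f a \<alpha>} \<in> H \<theta>" using H_subset[OF S_H] by blast
  then have "vset {a \<in> elts S. rel f a \<alpha>} \<in> elts V" by (rule Y) (simp add: Y_elts)
  then show ?thesis using \<alpha> by blast
qed

text \<open>The order type of \<open>s \<inter> j (c (i + 1)) = j[c (i + 1)]\<close> is \<open>c (i + 1)\<close>.\<close>

lemma V_otp:
  assumes i: "i < n" and X: "elts X = {a \<in> elts S. otp (elts a \<inter> elts (c (Suc (Suc i)))) = c (Suc i)}"
  shows "X \<in> elts V"
proof -
  let ?d = "c i" and ?e = "c (Suc i)"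
  have M: "?d \<in> elts M" "?e \<in> elts M" using i c_M by auto
  have jd: "j ?d = ?e" "j ?e = c (Suc (Suc i))" by (simp_all add: c_Suc)
  have el: "elts ?e \<subseteq> elts l" using c_mono[of "Suc i" n] i unfolding l_def by simp
  then have el': "elts ?e \<subseteq> elts lam" using c_mono[of n "Suc n"] unfolding l_def lam_c by simp
  have "\<exists>g\<in>H \<theta>. otp_iso g ?e s (j ?e)"
  proof -
    obtain g where g: "g \<in> H \<theta>" "\<And>x y. rel g x y \<longleftrightarrow> x \<in> elts lam \<and> y \<in> elts lam \<and> (x \<in> elts ?e \<and> y = j x)"
      using exists_rel[OF closed lam_H, where P = "\<lambda>x y. x \<in> elts ?e \<and> y = j x"] by blast
    have *: "x \<in> elts M" "j x \<in> elts s" "j x \<in> elts lam" "j x \<in> elts (j ?e)" "x \<in> elts lam" if "x \<in> elts ?e" for x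
      using that el el' s_subset j_mem[of x ?e] M M_in unfolding elts_s by auto
    have inj: "x = x' \<longleftrightarrow> j x = j x'" if "x \<in> elts M" "x' \<in> elts M" for x x'
      using transfer[of x x' x x x x "FEq 0 2"] that by simp
    have onto_j: "\<exists>x\<in>elts ?e. y = j x" if "y \<in> elts s" "y \<in> elts (j ?e)" for y
    proof -
      obtain x where "x \<in> elts l" "y = j x" using \<open>y \<in> elts s\<close> unfolding elts_s by blast
      then show ?thesis using that(2) j_mem[of x ?e] M M_in[OF l_M] by blast
    qed
    have "otp_iso g ?e s (j ?e)"
      unfolding otp_iso_def
    proof (intro conjI ballI impI)
      fix x assume "x \<in> elts ?e"
      then show "\<exists>y\<in>elts s. y \<in> elts (j ?e) \<and> rel g x y" using * g(2) by blast
    next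
      fix y assume "y \<in> elts s" "y \<in> elts (j ?e)"
      then obtain x where "x \<in> elts ?e" "y = j x" using onto_j by blast
      then show "\<exists>x\<in>elts ?e. rel g x y" using * g(2) by blast
    next
      fix x x' y y'
      assume "x \<in> elts ?e" "x' \<in> elts ?e" and r: "rel g x y \<and> rel g x' y'"
      then have m: "x \<in> elts M" "x' \<in> elts M" "y = j x" "y' = j x'" using * g(2) by blast+
      show "x \<in> elts x' \<longleftrightarrow> y \<in> elts y'" using m j_mem by simp
      show "x = x' \<longleftrightarrow> y = y'" using m inj by simp
    qed
    then show ?thesis using g(1) by blast
  qed
  then have iso: "\<exists>g\<in>H \<theta>. otp_iso g (j ?d) s (j ?e)" unfolding jd(1) .
  let ?\<phi> = "FAll 7 (FImp (FAll 10 (FIff (FMem 10 7) (FAnd (FMem 10 2) (FEx 11 (fIso 11 5 10 6))))) (FMem 7 0))"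
  have mem_W: "Y \<in> elts W" if Y: "Y \<in> elts M"
      "\<forall>a\<in>elts M. a \<in> elts Y \<longleftrightarrow> a \<in> elts Sbar \<and> (\<exists>g\<in>elts M. otp_iso g ?d a ?e)" for Y
  proof -
    have "Y \<in> elts W \<longleftrightarrow> (\<exists>g\<in>H \<theta>. otp_iso g (j ?d) s (j ?e))"
      by (rule mem_W_iff[where u = ?d and v = ?e and w = ?d and f = ?d and \<phi> = "FEx 8 (fIso 8 0 7 2)"
            and \<Phi> = "\<lambda>K u v w f a. \<exists>g\<in>K. otp_iso g u a v"])
        (use Y M in \<open>auto simp: sat_fIso\<close>)
    then show ?thesis using iso by blast
  qed
  let ?\<Phi> = "\<lambda>K V S lam k d e. \<forall>Y\<in>K. (\<forall>a\<in>K. a \<in> elts Y \<longleftrightarrow>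
      a \<in> elts S \<and> (\<exists>g\<in>K. otp_iso g d a e)) \<longrightarrow> Y \<in> elts V"
  have M_holds: "?\<Phi> (elts M) W Sbar l (c 0) ?d ?e"
    using mem_W by blast
  have *: "\<forall>Y\<in>H \<theta>. (\<forall>a\<in>H \<theta>. a \<in> elts Y \<longleftrightarrow>
      a \<in> elts S \<and> (\<exists>g\<in>H \<theta>. otp_iso g (j ?d) a (j ?e))) \<longrightarrow> Y \<in> elts V"
    by (rule reflect[where \<Phi> = ?\<Phi> and \<phi> = ?\<phi>, OF _ M_holds M]) (simp add: sat_fIso)
  let ?Y = "vset {a \<in> elts S. \<exists>g\<in>H \<theta>. otp_iso g ?e a (j ?e)}"
  have Y: "elts ?Y = {a \<in> elts S. \<exists>g\<in>H \<theta>. otp_iso g ?e a (j ?e)}"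
    by (rule elts_vset_subset[of _ S]) blast
  then have "?Y \<in> H \<theta>" using H_subset[OF S_H] by blast
  then have "?Y \<in> elts V" using * Y unfolding jd(1) by blast
  moreover have "elts ?Y \<subseteq> elts X"
    unfolding Y X jd(2)[symmetric] using otp_iso_otp c_ordinal[of "Suc i"] i by auto
  moreover have "elts X \<subseteq> elts S" using X by blast
  ultimately show ?thesis by (rule V_upward)
qed

text \<open>The members of \<open>V\<close> as collections, the format in which ultrafilters are given.\<close>

definition U :: "'v set set" where "U = elts ` elts V"

lemma mem_U: "X \<subseteq> elts S \<Longrightarrow> X \<in> U \<longleftrightarrow> vset X \<in> elts V"
proof
  assume "X \<subseteq> elts S" "vset X \<in> elts V"
  then show "X \<in> U" unfolding U_def using elts_vset_subset[of X S] by blast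
next
  assume "X \<in> U"
  then show "vset X \<in> elts V" unfolding U_def by auto
qed

lemma U_subset: "X \<in> U \<Longrightarrow> X \<subseteq> elts S"
  unfolding U_def using V_subset by blast

lemma U_ultrafilter: "ultrafilter_on (elts S) U"
  unfolding ultrafilter_on_def
proof (intro conjI ballI allI impI)
  show "U \<subseteq> Pow (elts S)" using U_subset by blast
  show "elts S \<in> U" unfolding U_def using S_mem_V by blast
  show "{} \<notin> U" unfolding U_def using V_nonempty by blast
next
  fix X Y assume "X \<in> U" and Y: "X \<subseteq> Y \<and> Y \<subseteq> elts S"
  then obtain x where "x \<in> elts V" "X = elts x" unfolding U_def by blast
  moreover have "elts (vset Y) = Y" using Y by (intro elts_vset_subset[of _ S]) simp
  ultimately have "vset Y \<in> elts V" using V_upward[of x "vset Y"] Y by simp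
  then show "Y \<in> U" using mem_U Y by simp
next
  fix X Y assume XY: "X \<in> U" "Y \<in> U"
  then obtain x y where "x \<in> elts V" "X = elts x" "y \<in> elts V" "Y = elts y" unfolding U_def by blast
  moreover have sub: "X \<inter> Y \<subseteq> elts S" using U_subset[OF XY(1)] by blast
  then have "elts (vset (X \<inter> Y)) = X \<inter> Y" by (rule elts_vset_subset)
  ultimately have "vset (X \<inter> Y) \<in> elts V" using V_Int[of x y "vset (X \<inter> Y)"] by simp
  then show "X \<inter> Y \<in> U" using mem_U[OF sub] by simp
next
  fix X assume X: "X \<subseteq> elts S"
  then have "elts (vset X) = X" by (rule elts_vset_subset)
  moreover have "elts (vset (elts S - X)) = elts S - X" by (intro elts_vset_subset[of _ S]) blast
  ultimately have "vset X \<in> elts V \<or> vset (elts S - X) \<in> elts V"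
    using V_ultra[of "vset X" "vset (elts S - X)"] X by simp
  then show "X \<in> U \<or> elts S - X \<in> U" using mem_U[OF X] mem_U[of "elts S - X"] by auto
qed

lemma U_normal_rel:
  assumes f: "f \<in> H \<theta>" and X: "X \<in> U"
    and "(\<exists>\<beta>\<in>elts (c (Suc 0)). \<forall>a\<in>X. \<exists>y\<in>elts \<beta>. rel f a y) \<or> (\<forall>a\<in>X. \<exists>y\<in>elts a. rel f a y)"
  shows "\<exists>\<alpha>\<in>elts lam. {a \<in> elts S. rel f a \<alpha>} \<in> U"
proof -
  obtain x where "x \<in> elts V" "X = elts x" using X unfolding U_def by blast
  then obtain \<alpha> where \<alpha>: "\<alpha> \<in> elts lam" "vset {a \<in> elts S. rel f a \<alpha>} \<in> elts V"
    using V_normal[OF f, of x] assms(3) by auto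
  have "{a \<in> elts S. rel f a \<alpha>} \<subseteq> elts S" by blast
  then show ?thesis using mem_U \<alpha> by blast
qed

lemma U_normal: "normal_on_vpow lam U"
  unfolding normal_on_vpow_def S_def[symmetric]
proof (intro conjI ballI impI)
  fix \<alpha> assume "\<alpha> \<in> elts lam"
  moreover have "elts (vset {a \<in> elts S. \<alpha> \<in> elts a}) = {a \<in> elts S. \<alpha> \<in> elts a}"
    by (rule elts_vset_subset[of _ S]) blast
  ultimately have "vset {a \<in> elts S. \<alpha> \<in> elts a} \<in> elts V" by (rule V_fine)
  moreover have "{a \<in> elts S. \<alpha> \<in> elts a} \<subseteq> elts S" by blast
  ultimately show "{a \<in> elts S. \<alpha> \<in> elts a} \<in> U" using mem_U by blast
next
  fix g assume g: "g \<in> elts S \<rightarrow> elts lam" and X: "{a \<in> elts S. g a \<in> elts a} \<in> U"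
  obtain f where f: "f \<in> H \<theta>" "\<And>x y. rel f x y \<longleftrightarrow> x \<in> elts S \<and> y \<in> elts S \<and> y = g x"
    using exists_rel[OF closed S_H, where P = "\<lambda>x y. y = g x"] by blast
  have rel: "rel f a y \<longleftrightarrow> y = g a" if "a \<in> elts S" for a y
    using f(2)[of a y] that funcset_mem[OF g that] subset_S by auto
  have "\<forall>a\<in>{a \<in> elts S. g a \<in> elts a}. \<exists>y\<in>elts a. rel f a y" by (auto simp: rel)
  then obtain \<alpha> where "\<alpha> \<in> elts lam" "{a \<in> elts S. rel f a \<alpha>} \<in> U"
    using U_normal_rel[OF f(1) X disjI2] by blast
  moreover have "{a \<in> elts S. rel f a \<alpha>} = {a \<in> elts S. g a = \<alpha>}" using rel by auto
  ultimately show "\<exists>\<alpha>\<in>elts lam. {a \<in> elts S. g a = \<alpha>} \<in> U" by auto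
qed

text \<open>If the intersection of fewer than \<open>\<kappa>\<close> members \<open>g y\<close>, for \<open>y \<in> \<beta>\<close>, were not a member, almost all \<open>a\<close> would
  be related to some \<open>y \<in> \<beta>\<close> by \<open>a \<notin> g y\<close>. Then almost all \<open>a\<close> would be outside one and the same \<open>g \<alpha>\<close>.\<close>

lemma U_complete: "kappa_complete (c (Suc 0)) U"
  unfolding kappa_complete_def
proof (intro allI impI, elim conjE)
  fix F assume F: "F \<subseteq> U" "F \<noteq> {}" "F \<prec> elts (c (Suc 0))"
  show "\<Inter>F \<in> U"
  proof (rule ccontr)
    assume neg: "\<Inter>F \<notin> U"
    have Fsub: "\<Inter>F \<subseteq> elts S" using F(1,2) U_subset by blast
    have compl: "elts S - \<Inter>F \<in> U"
      using U_ultrafilter neg Fsub unfolding ultrafilter_on_def by blast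
    have inj: "inj_on vset F"
      using F(1) U_subset by (intro inj_onI) (metis elts_vset_subset subsetD)
    then have less: "vset ` F \<prec> elts (c (Suc 0))" using F(3) by simp
    then obtain \<beta> :: 'v where \<beta>: "ordinal \<beta>" "vset ` F \<approx> elts \<beta>"
      by (rule small_eqpoll_ordinal[OF small_if_lesspoll])
    then have "elts \<beta> \<prec> elts (c (Suc 0))" using eq_lesspoll_trans[OF eqpoll_sym[OF \<beta>(2)] less] by blast
    then have \<beta>k: "\<beta> \<in> elts (c (Suc 0))" using cardinal_mem_iff[OF c_cardinal[of 0] \<beta>(1)] by blast
    have "F \<approx> elts \<beta>" using inj \<beta>(2) by simp
    then obtain g where g: "g ` elts \<beta> = F" using eqpoll_sym unfolding eqpoll_def bij_betw_def by metis
    obtain f where f: "f \<in> H \<theta>"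
        "\<And>a y. rel f a y \<longleftrightarrow> a \<in> elts S \<and> y \<in> elts S \<and> (y \<in> elts \<beta> \<and> a \<notin> g y)"
      using exists_rel[OF closed S_H, where P = "\<lambda>a y. y \<in> elts \<beta> \<and> a \<notin> g y"] by blast
    have "elts \<beta> \<subseteq> elts (c (Suc 0))" using \<beta>k ordinal_subset[OF c_ordinal[of "Suc 0"]] by simp
    moreover have "elts (c (Suc 0)) \<subseteq> elts lam" unfolding lam_c by (rule c_mono) auto
    ultimately have \<beta>S: "elts \<beta> \<subseteq> elts S" using subset_S by blast
    have "\<forall>a\<in>elts S - \<Inter>F. \<exists>y\<in>elts \<beta>. rel f a y" unfolding f(2) g[symmetric] using \<beta>S by blast
    then obtain \<alpha> where \<alpha>: "{a \<in> elts S. rel f a \<alpha>} \<in> U"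
      using U_normal_rel[OF f(1) compl disjI1] \<beta>k by blast
    have "{} \<notin> U" using U_ultrafilter unfolding ultrafilter_on_def by blast
    then have "{a \<in> elts S. rel f a \<alpha>} \<noteq> {}" using \<alpha> by metis
    then have "\<alpha> \<in> elts \<beta>" unfolding f(2) by blast
    then have "g \<alpha> \<in> U" using g F(1) by blast
    then have "{a \<in> elts S. rel f a \<alpha>} \<inter> g \<alpha> \<in> U"
      using U_ultrafilter \<alpha> unfolding ultrafilter_on_def by blast
    moreover have "{a \<in> elts S. rel f a \<alpha>} \<inter> g \<alpha> = {}" unfolding f(2) by blast
    ultimately show False using \<open>{} \<notin> U\<close> by simp
  qed
qed

lemma n_huge_crit: "n_huge n (j (crit (elts M) j))"
proof -
  have k: "c (Suc 0) = j (crit (elts M) j)" unfolding c_def by simp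
  have "{a \<in> elts S. otp (elts a \<inter> elts (c (Suc (Suc i)))) = c (Suc i)} \<in> U" if "i < n" for i
  proof -
    have "{a \<in> elts S. otp (elts a \<inter> elts (c (Suc (Suc i)))) = c (Suc i)} \<subseteq> elts S" by blast
    then show ?thesis using V_otp[OF that elts_vset_subset] mem_U by blast
  qed
  moreover have "uncountable (elts (c (Suc 0)))"
    using crit_uncountable[OF nt cardinal_j_crit] k by simp
  ultimately show ?thesis
    unfolding n_huge_def k[symmetric]
    using c_cardinal c_inc U_ultrafilter U_complete U_normal c_cardinal[of 0]
    unfolding lam_c S_def
    by (intro conjI exI[of _ "\<lambda>i. c (Suc i)"] exI[of _ U]) auto
qed

end

theorem lemma6p7:
  fixes n :: nat and \<kappa> :: "'v::zfc"
  assumes "0 < n" and "cardinal \<kappa>"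
  shows "n_huge n \<kappa> \<longleftrightarrow>
    for_all_sufficiently_large_cardinals \<kappa> (\<lambda>\<theta>.
      \<exists>M j. small_embedding \<kappa> \<theta> M j \<and>
        (\<forall>i\<le>n. (j ^^ i) (crit (elts M) j) \<in> elts M) \<and>
        vset {A \<in> elts (vpow_in M (vpow_in M ((j ^^ n) (crit (elts M) j)))).
                vset (j ` elts ((j ^^ n) (crit (elts M) j))) \<in> elts (j A)} \<in> elts M)"
  (is "_ \<longleftrightarrow> for_all_sufficiently_large_cardinals \<kappa> ?P")
proof
  assume "n_huge n \<kappa>"
  then show "for_all_sufficiently_large_cardinals \<kappa> ?P"
    using n_huge_imp_small_embedding[OF \<open>0 < n\<close>] by blast
next
  assume "for_all_sufficiently_large_cardinals \<kappa> ?P"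
  then obtain \<alpha> where \<alpha>: "ordinal \<alpha>" "\<And>\<theta>. cardinal \<theta> \<Longrightarrow> \<alpha> \<in> elts \<theta> \<Longrightarrow> ?P \<theta>"
    unfolding for_all_sufficiently_large_cardinals_def by blast
  \<comment> \<open>The embedding is needed at a single cardinal only, a strong limit.\<close>
  obtain \<theta> where \<theta>: "cardinal \<theta>" "\<alpha> \<in> elts \<theta>" "\<And>x. x \<in> H \<theta> \<Longrightarrow> vpow x \<in> H \<theta>"
    by (rule exists_strong_limit[OF \<alpha>(1)]) (rule that)
  then obtain M j where small: "small_embedding \<kappa> \<theta> M j"
    and it: "\<forall>i\<le>n. (j ^^ i) (crit (elts M) j) \<in> elts M"
    and W: "vset {A \<in> elts (vpow_in M (vpow_in M ((j ^^ n) (crit (elts M) j)))).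
                vset (j ` elts ((j ^^ n) (crit (elts M) j))) \<in> elts (j A)} \<in> elts M"
    using \<alpha>(2)[OF \<theta>(1,2)] by (elim exE conjE)
  interpret measure_embedding M \<theta> j n
    using small it W assms \<theta>(3) trans_class_H unfolding small_embedding_def
    by unfold_locales auto
  show "n_huge n \<kappa>" using n_huge_crit small unfolding small_embedding_def by simp
qed

end
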